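(* Let $R$ be a P$v$MD. The following conditions are equivalent: (i) $R$ is a generalized Krull domain; (ii) each radical $t$-ideal of $R$ is divisorial and each divisorial ideal of $R$ is $w$-stable; (iii) each radical $t$-ideal of $R$ is $w$-stable; (iv) each $t$-prime ideal of $R$ is $w$-stable.
   Context: $R$ is an integral domain with quotient field $K\neq R$. For nonzero $R$-submodules $A,B$ of $K$, $(A:B)=\{x\in K: xB\subseteq A\}$; $E(I)=(I:I)$. For a nonzero fractional ideal $I$, $I_v=(R:(R:I))$ ($I$ divisorial if $I=I_v$), $I_t=\bigcup\{J_v: J\subseteq I\text{ nonzero finitely generated}\}$ ($I$ a $t$-ideal if $I=I_t$); $t$-primes are prime $t$-ideals; $t\text{-Max}(R)$ is the set of ideals maximal among proper $t$-ideals. For a nonzero $R$-submodule $E$ of $K$, $E_w=\bigcap_{M\in t\text{-Max}(R)}ER_M$; $I$ is a $w$-ideal if $I=I_w$. A $w$-ideal $I$ is $w$-stable if $(I(E(I):I))_w=E(I)$. $R$ is a P$v$MD if $R_M$ is a valuation domain for each $M\in t\text{-Max}(R)$. A P$v$MD is strongly discrete if $(P^2)_t\neq P$ for each $t$-prime $P$. A generalized Krull domain is a strongly discrete P$v$MD satisfying the ascending chain condition on radical $t$-ideals. *)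

theory Defs
  imports Main
begin

text \<open>Setting: an integral domain R is modelled as a subring of a field K (the type 'a),
  such that K is the quotient field of R.  Fractional ideals, submodules etc. are subsets of K.\<close>

definition is_subring :: "'a::field set \<Rightarrow> bool" where
  "is_subring R \<longleftrightarrow> 0 \<in> R \<and> 1 \<in> R \<and> (\<forall>a\<in>R. \<forall>b\<in>R. a + b \<in> R \<and> a - b \<in> R \<and> a * b \<in> R)"

definition is_quotient_field_of :: "'a::field set \<Rightarrow> bool" where
  "is_quotient_field_of R \<longleftrightarrow> (\<forall>x. \<exists>a\<in>R. \<exists>b\<in>R. b \<noteq> 0 \<and> x = a / b)"

definition domain_with_qf :: "'a::field set \<Rightarrow> bool" where
  "domain_with_qf R \<longleftrightarrow> is_subring R \<and> is_quotient_field_of R \<and> R \<noteq> UNIV"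

definition submod :: "'a::field set \<Rightarrow> 'a set \<Rightarrow> bool" where
  "submod R A \<longleftrightarrow> 0 \<in> A \<and> (\<forall>a\<in>A. \<forall>b\<in>A. a + b \<in> A) \<and> (\<forall>r\<in>R. \<forall>a\<in>A. r * a \<in> A)"

definition genmod :: "'a::field set \<Rightarrow> 'a set \<Rightarrow> 'a set" where
  "genmod R S = \<Inter> {A. submod R A \<and> S \<subseteq> A}"

definition mprod :: "'a::field set \<Rightarrow> 'a set \<Rightarrow> 'a set \<Rightarrow> 'a set" where
  "mprod R A B = genmod R {a * b | a b. a \<in> A \<and> b \<in> B}"

definition colon :: "'a::field set \<Rightarrow> 'a set \<Rightarrow> 'a set" where
  "colon A B = {x. \<forall>b\<in>B. x * b \<in> A}"

definition Eend :: "'a::field set \<Rightarrow> 'a set" where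
  "Eend I = colon I I"

definition frac_ideal :: "'a::field set \<Rightarrow> 'a set \<Rightarrow> bool" where
  "frac_ideal R I \<longleftrightarrow> submod R I \<and> I \<noteq> {0} \<and> (\<exists>d\<in>R. d \<noteq> 0 \<and> (\<forall>x\<in>I. d * x \<in> R))"

definition ideal :: "'a::field set \<Rightarrow> 'a set \<Rightarrow> bool" where
  "ideal R I \<longleftrightarrow> submod R I \<and> I \<subseteq> R"

definition vop :: "'a::field set \<Rightarrow> 'a set \<Rightarrow> 'a set" where
  "vop R I = colon R (colon R I)"

definition divisorial :: "'a::field set \<Rightarrow> 'a set \<Rightarrow> bool" where
  "divisorial R I \<longleftrightarrow> frac_ideal R I \<and> I = vop R I"

definition fin_gen :: "'a::field set \<Rightarrow> 'a set \<Rightarrow> bool" where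
  "fin_gen R J \<longleftrightarrow> (\<exists>S. finite S \<and> J = genmod R S)"

definition t_op :: "'a::field set \<Rightarrow> 'a set \<Rightarrow> 'a set" where
  "t_op R I = \<Union> {vop R J | J. J \<subseteq> I \<and> J \<noteq> {0} \<and> submod R J \<and> fin_gen R J}"

definition t_ideal :: "'a::field set \<Rightarrow> 'a set \<Rightarrow> bool" where
  "t_ideal R I \<longleftrightarrow> frac_ideal R I \<and> I = t_op R I"

definition prime_ideal :: "'a::field set \<Rightarrow> 'a set \<Rightarrow> bool" where
  "prime_ideal R P \<longleftrightarrow> ideal R P \<and> P \<noteq> R \<and> (\<forall>a\<in>R. \<forall>b\<in>R. a * b \<in> P \<longrightarrow> a \<in> P \<or> b \<in> P)"

definition t_prime :: "'a::field set \<Rightarrow> 'a set \<Rightarrow> bool" where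
  "t_prime R P \<longleftrightarrow> prime_ideal R P \<and> t_ideal R P"

definition radical_ideal :: "'a::field set \<Rightarrow> 'a set \<Rightarrow> bool" where
  "radical_ideal R I \<longleftrightarrow> ideal R I \<and> (\<forall>x\<in>R. (\<exists>n>0. x ^ n \<in> I) \<longrightarrow> x \<in> I)"

definition t_Max :: "'a::field set \<Rightarrow> 'a set set" where
  "t_Max R = {M. ideal R M \<and> t_ideal R M \<and> M \<noteq> R \<and>
      (\<forall>J. ideal R J \<and> t_ideal R J \<and> J \<noteq> R \<and> M \<subseteq> J \<longrightarrow> J = M)}"

definition loc :: "'a::field set \<Rightarrow> 'a set \<Rightarrow> 'a set" where
  "loc R M = {a / s | a s. a \<in> R \<and> s \<in> R \<and> s \<notin> M}"

definition wop :: "'a::field set \<Rightarrow> 'a set \<Rightarrow> 'a set" where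
  "wop R E = \<Inter> {genmod (loc R M) E | M. M \<in> t_Max R}"

definition w_ideal :: "'a::field set \<Rightarrow> 'a set \<Rightarrow> bool" where
  "w_ideal R I \<longleftrightarrow> I = wop R I"

definition w_stable :: "'a::field set \<Rightarrow> 'a set \<Rightarrow> bool" where
  "w_stable R I \<longleftrightarrow> w_ideal R I \<and> wop R (mprod R I (colon (Eend I) I)) = Eend I"

definition valuation_domain :: "'a::field set \<Rightarrow> bool" where
  "valuation_domain V \<longleftrightarrow> (\<forall>x. x \<noteq> 0 \<longrightarrow> x \<in> V \<or> inverse x \<in> V)"

definition PvMD :: "'a::field set \<Rightarrow> bool" where
  "PvMD R \<longleftrightarrow> (\<forall>M\<in>t_Max R. valuation_domain (loc R M))"

definition strongly_discrete :: "'a::field set \<Rightarrow> bool" where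
  "strongly_discrete R \<longleftrightarrow> PvMD R \<and> (\<forall>P. t_prime R P \<longrightarrow> t_op R (mprod R P P) \<noteq> P)"

definition acc_radical_t :: "'a::field set \<Rightarrow> bool" where
  "acc_radical_t R \<longleftrightarrow> (\<forall>f :: nat \<Rightarrow> 'a set.
      (\<forall>n. radical_ideal R (f n) \<and> t_ideal R (f n)) \<and> (\<forall>n. f n \<subseteq> f (Suc n))
      \<longrightarrow> (\<exists>N. \<forall>n\<ge>N. f n = f N))"

definition generalized_Krull :: "'a::field set \<Rightarrow> bool" where
  "generalized_Krull R \<longleftrightarrow> strongly_discrete R \<and> acc_radical_t R"

end

theory Submission
  imports Defs
begin

text \<open>
  In a P\<open>v\<close>MD the \<open>t\<close>- and \<open>w\<close>-operations agree, a finite set \<open>J\<close> satisfies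
  \<open>J (R : J) \<not>\<subseteq> M\<close> for every \<open>t\<close>-maximal \<open>M\<close>, and the primes inside a fixed \<open>M\<close> form a chain.

  If a \<open>t\<close>-prime \<open>P\<close> is \<open>w\<close>-stable with endomorphism ring \<open>E\<close>, then \<open>P (E : P)\<close> lies in no
  \<open>M\<close>. This is witnessed by a finite \<open>J \<subseteq> P\<close>, and \<open>E \<subseteq> R\<^sub>P\<close> forces every \<open>t\<close>-prime over
  \<open>J\<close> to contain \<open>P\<close>; a Cohen-type Zorn argument then gives the chain condition. It also shows
  that \<open>P\<close> is not \<open>t\<close>-idempotent.

  Conversely, let \<open>R\<close> be generalized Krull, \<open>I\<close> divisorial, \<open>B = (R : I)\<close>, \<open>E = (I : I) = (R : BI)\<close> and
  \<open>D = I (E : I) \<inter> R\<close>. The chain condition provides finitely many primes \<open>P\<close> minimal over \<open>D\<close>, and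
  strong discreteness gives \<open>I R\<^sub>P = a R\<^sub>Q\<close> with \<open>a \<in> I\<close> and \<open>BI \<subseteq> Q \<subseteq> P\<close>. For a finite
  \<open>J \<subseteq> I\<close> containing these \<open>a\<close> and witnesses for finitely many generators of \<open>D\<close> up to radical,
  \<open>(R : J) B I I \<subseteq> R\<close> can be checked at each \<open>M\<close>. So \<open>(R : J) \<subseteq> (E : I)\<close>, and
  \<open>J (R : J)\<close> already lies in no \<open>M\<close>.
\<close>

section \<open>Submodules and colons\<close>

lemma genmod_least: "submod R A \<Longrightarrow> S \<subseteq> A \<Longrightarrow> genmod R S \<subseteq> A"
  by (auto simp: genmod_def)

lemma genmod_superset: "S \<subseteq> genmod R S"
  by (auto simp: genmod_def)

lemma submod_genmod: "submod R (genmod R S)"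
  by (auto simp: genmod_def submod_def)

lemma submod_colon: "submod R A \<Longrightarrow> submod R (colon A B)"
  by (auto simp: colon_def submod_def distrib_right mult.assoc)

lemma submod_mprod: "submod R (mprod R A B)"
  by (simp add: mprod_def submod_genmod)

lemma mprod_memI: "a \<in> A \<Longrightarrow> b \<in> B \<Longrightarrow> a * b \<in> mprod R A B"
  unfolding mprod_def by (rule subsetD[OF genmod_superset]) auto

lemma mprod_least:
  assumes "submod R C" and "\<And>a b. a \<in> A \<Longrightarrow> b \<in> B \<Longrightarrow> a * b \<in> C"
  shows "mprod R A B \<subseteq> C"
  unfolding mprod_def using assms by (intro genmod_least) auto

lemma mprod_mono: "A \<subseteq> A' \<Longrightarrow> B \<subseteq> B' \<Longrightarrow> mprod R A B \<subseteq> mprod R A' B'"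
  by (intro mprod_least submod_mprod mprod_memI) auto

lemma submod_zero: "submod R A \<Longrightarrow> 0 \<in> A"
  and submod_add: "submod R A \<Longrightarrow> a \<in> A \<Longrightarrow> b \<in> A \<Longrightarrow> a + b \<in> A"
  and submod_mult: "submod R A \<Longrightarrow> r \<in> R \<Longrightarrow> a \<in> A \<Longrightarrow> r * a \<in> A"
  by (auto simp: submod_def)

lemma submod_antimono: "submod S A \<Longrightarrow> R \<subseteq> S \<Longrightarrow> submod R A"
  by (auto simp: submod_def)

lemma submod_nonzero: "submod R A \<Longrightarrow> A \<noteq> {0} \<longleftrightarrow> (\<exists>a\<in>A. a \<noteq> 0)"
  using submod_zero by blast

lemma submod_scaled: "submod R A \<Longrightarrow> submod R {x. c * x \<in> A}"
  by (auto simp: submod_def distrib_left mult.left_commute)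

text \<open>The elements that need only finitely many left factors form a submodule containing every
  product \<open>a * b\<close>.\<close>

lemma mprod_finite_left:
  assumes "s \<in> mprod R A B"
  shows "\<exists>J. finite J \<and> J \<subseteq> A \<and> s \<in> mprod R J B"
proof -
  let ?C = "{s. \<exists>J. finite J \<and> J \<subseteq> A \<and> s \<in> mprod R J B}"
  have "mprod R A B \<subseteq> ?C"
  proof (rule mprod_least)
    show "submod R ?C"
      unfolding submod_def
    proof (intro conjI ballI)
      show "0 \<in> ?C"
        using submod_zero[OF submod_mprod, of R "{}" B] by blast
    next
      fix a b assume "a \<in> ?C" "b \<in> ?C"
      then obtain J J' where J: "finite J" "J \<subseteq> A" "a \<in> mprod R J B"
        and J': "finite J'" "J' \<subseteq> A" "b \<in> mprod R J' B" by blast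
      have "a \<in> mprod R (J \<union> J') B" "b \<in> mprod R (J \<union> J') B"
        using J(3) J'(3) mprod_mono[of J "J \<union> J'" B B R] mprod_mono[of J' "J \<union> J'" B B R] by auto
      then have "a + b \<in> mprod R (J \<union> J') B"
        by (rule submod_add[OF submod_mprod])
      then show "a + b \<in> ?C" using J J' by blast
    next
      fix r a assume r: "r \<in> R" and "a \<in> ?C"
      then obtain J where "finite J" "J \<subseteq> A" "a \<in> mprod R J B" by blast
      then show "r * a \<in> ?C" using submod_mult[OF submod_mprod r, of a J B] by blast
    qed
  next
    fix a b assume ab: "a \<in> A" "b \<in> B"
    then have "a * b \<in> mprod R {a} B" by (intro mprod_memI) auto
    then show "a * b \<in> ?C" using ab by blast
  qed
  then show ?thesis using assms by blast
qed

lemma mprod_finite_left_set: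
  assumes "finite F" and "F \<subseteq> mprod R A B"
  shows "\<exists>J. finite J \<and> J \<subseteq> A \<and> F \<subseteq> mprod R J B"
  using assms
proof (induction F rule: finite_induct)
  case empty
  then show ?case by blast
next
  case (insert s F)
  then obtain J J' where J: "finite J" "J \<subseteq> A" "F \<subseteq> mprod R J B"
    and J': "finite J'" "J' \<subseteq> A" "s \<in> mprod R J' B"
    using mprod_finite_left[of s R A B] by blast
  have "insert s F \<subseteq> mprod R (J \<union> J') B"
    using J(3) J'(3) mprod_mono[of J "J \<union> J'" B B R] mprod_mono[of J' "J \<union> J'" B B R] by auto
  then show ?case using J J' by (intro exI[of _ "J \<union> J'"]) auto
qed

text \<open>Multiplication by \<open>x\<close> acts on the right factors and keeps the left ones.
  With \<open>C = (E : I)\<close> and \<open>x\<close> in \<open>I\<close> it carries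
  \<open>J (E : I)\<close> into \<open>J E\<close>.\<close>

lemma mprod_mult_right:
  assumes "s \<in> mprod R J C" and "\<And>c. c \<in> C \<Longrightarrow> x * c \<in> E"
  shows "x * s \<in> mprod R J E"
proof -
  have "mprod R J C \<subseteq> {s. x * s \<in> mprod R J E}"
    by (rule mprod_least[OF submod_scaled[OF submod_mprod]])
       (auto simp: mult.left_commute intro!: mprod_memI assms(2))
  then show ?thesis using assms(1) by blast
qed

text \<open>A multiplier sending \<open>S\<close> into \<open>R\<close> sends the span of
  \<open>S\<close> into \<open>R\<close>. Hence v-closures of finitely generated modules can be
  computed from finite sets.\<close>

lemma colon_genmod: "submod R R \<Longrightarrow> colon R (genmod R S) = colon R S"
proof
  assume R: "submod R R"
  show "colon R (genmod R S) \<subseteq> colon R S"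
    using genmod_superset[of S R] by (auto simp: colon_def)
  show "colon R S \<subseteq> colon R (genmod R S)"
  proof
    fix x assume "x \<in> colon R S"
    then have "genmod R S \<subseteq> {y. x * y \<in> R}"
      by (intro genmod_least submod_scaled[OF R]) (auto simp: colon_def)
    then show "x \<in> colon R (genmod R S)" by (auto simp: colon_def)
  qed
qed

lemma vop_colon: "x \<in> vop R S \<Longrightarrow> y \<in> colon R S \<Longrightarrow> x * y \<in> R"
  by (simp add: vop_def colon_def)

lemma vop_superset: "S \<subseteq> vop R S"
  by (auto simp: vop_def colon_def mult.commute)

lemma vop_mono: "S \<subseteq> S' \<Longrightarrow> vop R S \<subseteq> vop R S'"
  by (auto simp: vop_def colon_def)

lemma vop_least: "S \<subseteq> vop R S' \<Longrightarrow> vop R S \<subseteq> vop R S'"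
  by (auto simp: vop_def colon_def mult.commute subset_iff) (metis mult.commute)

lemma vop_scale: "x \<in> vop R S \<Longrightarrow> c * x \<in> vop R ((*) c ` S)"
  unfolding vop_def colon_def by (auto simp: ac_simps) (metis mult.assoc mult.commute)

lemma Inter_divisorial:
  "(\<And>I. I \<in> \<I> \<Longrightarrow> vop R I = I) \<Longrightarrow> vop R (\<Inter>\<I>) = \<Inter>\<I>"
  using vop_superset[of "\<Inter>\<I>" R] vop_mono[of "\<Inter>\<I>" _ R] by blast

lemma t_op_mono: "A \<subseteq> B \<Longrightarrow> t_op R A \<subseteq> t_op R B"
  unfolding t_op_def by blast

lemma prime_idealD:
  assumes "prime_ideal R P"
  shows "ideal R P" "submod R P" "P \<subseteq> R" "P \<noteq> R" "0 \<in> P"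
    and "\<And>a b. a \<in> R \<Longrightarrow> b \<in> R \<Longrightarrow> a * b \<in> P \<Longrightarrow> a \<in> P \<or> b \<in> P"
  using assms by (auto simp: prime_ideal_def ideal_def submod_def)

lemma t_MaxD:
  assumes "M \<in> t_Max R"
  shows "ideal R M" "submod R M" "M \<subseteq> R" "M \<noteq> R" "t_ideal R M" "t_op R M = M" "M \<noteq> {0}"
  using assms by (auto simp: t_Max_def ideal_def t_ideal_def frac_ideal_def)

lemma t_Max_maximal:
  assumes "M \<in> t_Max R" "N \<in> t_Max R" "M \<subseteq> N"
  shows "N = M"
proof -
  have "\<forall>J. ideal R J \<and> t_ideal R J \<and> J \<noteq> R \<and> M \<subseteq> J \<longrightarrow> J = M"
    using assms(1) by (simp add: t_Max_def)
  then show ?thesis using t_MaxD(1,4,5)[OF assms(2)] assms(3) by simp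
qed

section \<open>The t- and w-operations\<close>

locale qf_domain =
  fixes R :: "'a::field set"
  assumes dom: "domain_with_qf R"
begin

lemma R_zero: "0 \<in> R" and R_one: "1 \<in> R"
  and R_add: "a \<in> R \<Longrightarrow> b \<in> R \<Longrightarrow> a + b \<in> R"
  and R_mult: "a \<in> R \<Longrightarrow> b \<in> R \<Longrightarrow> a * b \<in> R"
  using dom by (auto simp: domain_with_qf_def is_subring_def)

lemma R_power: "a \<in> R \<Longrightarrow> a ^ n \<in> R"
  by (induction n) (auto simp: R_one R_mult)

lemma denominator: obtains b where "b \<in> R" "b \<noteq> 0" "b * x \<in> R"
proof -
  obtain a b where "a \<in> R" "b \<in> R" "b \<noteq> 0" "x = a / b"
    using dom unfolding domain_with_qf_def is_quotient_field_of_def by blast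
  then show ?thesis using that by simp
qed

lemma submod_R: "submod R R"
  by (auto simp: submod_def R_zero R_add R_mult)

lemma ideal_eq_R: "ideal R A \<Longrightarrow> 1 \<in> A \<Longrightarrow> A = R"
  unfolding ideal_def using submod_mult[of R A _ 1] by auto

lemma prime_not_one: "prime_ideal R P \<Longrightarrow> 1 \<notin> P"
  using prime_idealD(1,4) ideal_eq_R by blast

lemma ideal_frac: "ideal R A \<Longrightarrow> A \<noteq> {0} \<Longrightarrow> frac_ideal R A"
  unfolding ideal_def frac_ideal_def using R_one by (metis mult_1 subsetD zero_neq_one)

lemma t_idealI: "ideal R A \<Longrightarrow> A \<noteq> {0} \<Longrightarrow> t_op R A = A \<Longrightarrow> t_ideal R A"
  by (simp add: t_ideal_def ideal_frac)

lemma submod_vop: "submod R (vop R S)"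
  by (simp add: vop_def submod_colon submod_R)

lemma mem_t_op:
  assumes "submod R A"
  shows "x \<in> t_op R A \<longleftrightarrow> (\<exists>S. finite S \<and> S \<subseteq> A \<and> (\<exists>s\<in>S. s \<noteq> 0) \<and> x \<in> vop R S)"
proof
  assume "x \<in> t_op R A"
  then obtain S where S: "x \<in> vop R (genmod R S)" "genmod R S \<subseteq> A" "genmod R S \<noteq> {0}" "finite S"
    unfolding t_op_def fin_gen_def by blast
  have "\<exists>s\<in>S. s \<noteq> 0"
  proof (rule ccontr)
    assume "\<not> ?thesis"
    then have "genmod R S \<subseteq> {0}" by (intro genmod_least) (auto simp: submod_def)
    then show False using S(3) submod_zero[OF submod_genmod, of R S] by auto
  qed
  then show "\<exists>S. finite S \<and> S \<subseteq> A \<and> (\<exists>s\<in>S. s \<noteq> 0) \<and> x \<in> vop R S"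
    using S genmod_superset[of S R] by (intro exI[of _ S]) (auto simp: vop_def colon_genmod submod_R)
next
  assume "\<exists>S. finite S \<and> S \<subseteq> A \<and> (\<exists>s\<in>S. s \<noteq> 0) \<and> x \<in> vop R S"
  then obtain S where S: "finite S" "S \<subseteq> A" "\<exists>s\<in>S. s \<noteq> 0" "x \<in> vop R S" by blast
  have "x \<in> vop R (genmod R S)" using S by (auto simp: vop_def colon_genmod submod_R)
  moreover have "genmod R S \<subseteq> A" using S assms by (intro genmod_least)
  moreover have "genmod R S \<noteq> {0}" using S(3) genmod_superset[of S R] by blast
  ultimately show "x \<in> t_op R A"
    unfolding t_op_def fin_gen_def using S(1) submod_genmod[of R S] by blast
qed

lemma t_opE:
  assumes "x \<in> t_op R A" "submod R A"
  obtains S where "finite S" "S \<subseteq> A" "\<exists>s\<in>S. s \<noteq> 0" "x \<in> vop R S"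
  using iffD1[OF mem_t_op[OF assms(2)] assms(1)] by blast

lemma t_op_superset:
  assumes "submod R A" "A \<noteq> {0}"
  shows "A \<subseteq> t_op R A"
proof
  fix x assume x: "x \<in> A"
  obtain a where "a \<in> A" "a \<noteq> 0" using assms submod_nonzero by blast
  then show "x \<in> t_op R A" using x vop_superset[of "{x,a}" R]
    by (subst mem_t_op[OF assms(1)]) (intro exI[of _ "{x,a}"], auto)
qed

lemma submod_t_op:
  assumes "submod R A" "A \<noteq> {0}"
  shows "submod R (t_op R A)"
  unfolding submod_def
proof (intro conjI ballI)
  show "0 \<in> t_op R A" using t_op_superset[OF assms] submod_zero[OF assms(1)] by blast
next
  fix x y assume "x \<in> t_op R A" "y \<in> t_op R A"
  then obtain S S' where S: "finite S" "S \<subseteq> A" "\<exists>s\<in>S. s \<noteq> 0" "x \<in> vop R S"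
    and S': "finite S'" "S' \<subseteq> A" "y \<in> vop R S'"
    using mem_t_op[OF assms(1)] by metis
  have "x + y \<in> vop R (S \<union> S')"
    using S S' vop_mono[of S "S \<union> S'" R] vop_mono[of S' "S \<union> S'" R]
    by (intro submod_add[OF submod_vop]) auto
  then show "x + y \<in> t_op R A" using S S'
    by (subst mem_t_op[OF assms(1)]) (intro exI[of _ "S \<union> S'"], auto)
next
  fix r x assume "r \<in> R" "x \<in> t_op R A"
  then show "r * x \<in> t_op R A"
    using submod_mult[OF submod_vop] unfolding mem_t_op[OF assms(1)] by blast
qed

text \<open>Finitely many elements of the t-closure lie in the v-closure of one common finite subset
  of \<open>A\<close>, and v-closure is idempotent.\<close>

lemma t_op_idem:
  assumes "submod R A" "A \<noteq> {0}"
  shows "t_op R (t_op R A) = t_op R A"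
proof
  show "t_op R A \<subseteq> t_op R (t_op R A)"
    by (intro t_op_mono t_op_superset assms)
  obtain a where a: "a \<in> A" "a \<noteq> 0" using assms submod_nonzero by blast
  have *: "\<exists>S'. finite S' \<and> S' \<subseteq> A \<and> (\<exists>s\<in>S'. s \<noteq> 0) \<and> S \<subseteq> vop R S'"
    if "finite S" "S \<subseteq> t_op R A" for S
    using that
  proof (induction S rule: finite_induct)
    case empty
    then show ?case using a by (intro exI[of _ "{a}"]) auto
  next
    case (insert x S)
    then obtain S1 S2 where S1: "finite S1" "S1 \<subseteq> A" "\<exists>s\<in>S1. s \<noteq> 0" "S \<subseteq> vop R S1"
      and S2: "finite S2" "S2 \<subseteq> A" "x \<in> vop R S2"
      using mem_t_op[OF assms(1), of x] by auto
    have "insert x S \<subseteq> vop R (S1 \<union> S2)"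
      using S1 S2 vop_mono[of S1 "S1 \<union> S2" R] vop_mono[of S2 "S1 \<union> S2" R] by auto
    then show ?case using S1 S2 by (intro exI[of _ "S1 \<union> S2"]) auto
  qed
  show "t_op R (t_op R A) \<subseteq> t_op R A"
  proof
    fix x assume "x \<in> t_op R (t_op R A)"
    then obtain S where S: "finite S" "S \<subseteq> t_op R A" "x \<in> vop R S"
      using mem_t_op[OF submod_t_op[OF assms]] by blast
    then show "x \<in> t_op R A"
      using *[OF S(1,2)] vop_least[of S R] unfolding mem_t_op[OF assms(1)] by blast
  qed
qed

lemma t_op_R: "t_op R R = R"
proof
  show "R \<subseteq> t_op R R" using R_one by (intro t_op_superset submod_R) auto
  show "t_op R R \<subseteq> R"
  proof
    fix x assume "x \<in> t_op R R"
    then obtain S where "S \<subseteq> R" "x \<in> vop R S" using mem_t_op[OF submod_R] by blast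
    then show "x \<in> R" using R_one unfolding vop_def colon_def by (force dest: spec[of _ 1])
  qed
qed

lemma t_op_ideal: "ideal R A \<Longrightarrow> A \<noteq> {0} \<Longrightarrow> ideal R (t_op R A)"
  unfolding ideal_def using submod_t_op t_op_mono[of A R R] t_op_R by blast

lemma ideal_Union_chain:
  assumes "subset.chain \<A> \<C>" "\<C> \<noteq> {}" "\<And>A. A \<in> \<A> \<Longrightarrow> ideal R A"
  shows "ideal R (\<Union>\<C>)"
proof -
  have I: "ideal R A" if "A \<in> \<C>" for A
    using that assms by (auto simp: subset.chain_def)
  have "a + b \<in> \<Union>\<C>" if ab: "a \<in> \<Union>\<C>" "b \<in> \<Union>\<C>" for a b
  proof -
    obtain A where "A \<in> \<C>" "{a,b} \<subseteq> A"
      using finite_subset_Union_chain[of "{a,b}" \<C> \<A>] assms(1,2) ab by auto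
    then show ?thesis using I[of A] by (auto simp: ideal_def submod_def)
  qed
  then show ?thesis using I assms(2)
    unfolding ideal_def submod_def by blast
qed

text \<open>Zorn is applied to all ideals over \<open>A\<close> whose t-closure misses 1, not only
  to t-ideals. A finite set witnessing 1 in the t-closure of a chain's union already lies in one
  member of the chain.\<close>

lemma t_Max_above:
  assumes A: "ideal R A" "A \<noteq> {0}" and "1 \<notin> t_op R A"
  shows "\<exists>M\<in>t_Max R. A \<subseteq> M"
proof -
  let ?A = "{B. ideal R B \<and> A \<subseteq> B \<and> 1 \<notin> t_op R B}"
  have "\<exists>M\<in>?A. \<forall>X\<in>?A. M \<subseteq> X \<longrightarrow> X = M"
  proof (rule subset_Zorn_nonempty)
    show "?A \<noteq> {}" using assms by blast
  next
    fix \<C> assume C: "\<C> \<noteq> {}" "subset.chain ?A \<C>"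
    have id: "ideal R (\<Union>\<C>)"
      by (rule ideal_Union_chain[OF C(2) C(1)]) auto
    have "1 \<notin> t_op R (\<Union>\<C>)"
    proof
      assume "1 \<in> t_op R (\<Union>\<C>)"
      then obtain S where S: "finite S" "S \<subseteq> \<Union>\<C>" "\<exists>s\<in>S. s \<noteq> 0" "1 \<in> vop R S"
        using mem_t_op id by (auto simp: ideal_def)
      obtain B where "B \<in> \<C>" "S \<subseteq> B"
        using finite_subset_Union_chain[OF S(1,2) C] by blast
      moreover then have B: "B \<in> ?A" using C(2) by (auto simp: subset.chain_def)
      ultimately have "1 \<in> t_op R B" using S mem_t_op[of B] by (auto simp: ideal_def)
      then show False using B by blast
    qed
    moreover have "A \<subseteq> \<Union>\<C>" using C by (force simp: subset.chain_def)
    ultimately show "\<Union>\<C> \<in> ?A" using id by blast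
  qed
  then obtain M where "M \<in> ?A" and max': "\<forall>X\<in>?A. M \<subseteq> X \<longrightarrow> X = M" by (rule bexE)
  then have M: "ideal R M" "A \<subseteq> M" "1 \<notin> t_op R M" by simp_all
  have max: "X = M" if "X \<in> ?A" "M \<subseteq> X" for X using bspec[OF max' that(1)] that(2) by simp
  have M0: "M \<noteq> {0}" using A M submod_zero[of R A] by (auto simp: ideal_def)
  have sM: "submod R M" using M by (simp add: ideal_def)
  \<comment> \<open>The t-closure of \<open>M\<close> again belongs to the Zorn family, because
    \<open>t_op\<close> is idempotent.\<close>
  have "t_op R M = M"
    using t_op_superset[OF sM M0] M t_op_ideal[OF M(1) M0] t_op_idem[OF sM M0]
    by (intro max) auto
  then have "t_ideal R M" by (intro t_idealI M M0)
  moreover have "M \<noteq> R" using M t_op_R R_one by auto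
  moreover have "J = M" if J: "ideal R J" "t_ideal R J" "J \<noteq> R" "M \<subseteq> J" for J
  proof (rule max)
    have "1 \<notin> J" using J ideal_eq_R by blast
    then show "J \<in> ?A" using J M by (auto simp: t_ideal_def)
  qed (use J in auto)
  ultimately show ?thesis using M unfolding t_Max_def by blast
qed

lemma ideal_adjoin:
  assumes "ideal R M" "a \<in> R"
  obtains B where "ideal R B" "M \<subseteq> B" "a \<in> B" "\<forall>x\<in>B. \<exists>m\<in>M. \<exists>r\<in>R. x = m + r * a"
proof -
  have sM: "submod R M" and MR: "M \<subseteq> R" using assms by (auto simp: ideal_def)
  define B where "B = {m + r * a | m r. m \<in> M \<and> r \<in> R}"
  have B_iff: "x \<in> B \<longleftrightarrow> (\<exists>m r. m \<in> M \<and> r \<in> R \<and> x = m + r * a)" for x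
    unfolding B_def by blast
  have aB: "a \<in> B" using submod_zero[OF sM] R_one unfolding B_iff by force
  have MB: "M \<subseteq> B" using R_zero unfolding B_def by force
  have "submod R B"
    unfolding submod_def
  proof (intro conjI ballI)
    show "0 \<in> B" using MB submod_zero[OF sM] by blast
  next
    fix x y assume "x \<in> B" "y \<in> B"
    then obtain m r m' r' where "m \<in> M" "r \<in> R" "m' \<in> M" "r' \<in> R" "x = m + r * a" "y = m' + r' * a"
      unfolding B_iff by blast
    then have "x + y = (m + m') + (r + r') * a" "m + m' \<in> M" "r + r' \<in> R"
      using submod_add[OF sM] R_add by (auto simp: algebra_simps)
    then show "x + y \<in> B" unfolding B_iff by blast
  next
    fix t x assume "t \<in> R" "x \<in> B"
    then obtain m r where "m \<in> M" "r \<in> R" "x = m + r * a" unfolding B_iff by blast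
    then have "t * x = t * m + (t * r) * a" "t * m \<in> M" "t * r \<in> R"
      using submod_mult[OF sM] R_mult \<open>t \<in> R\<close> by (auto simp: distrib_left mult.assoc)
    then show "t * x \<in> B" unfolding B_iff by blast
  qed
  moreover have "B \<subseteq> R" using MR assms(2) by (auto simp: B_iff intro!: R_add R_mult)
  ultimately have idB: "ideal R B" by (simp add: ideal_def)
  show ?thesis
    by (rule that[OF idB MB aB]) (unfold B_def, blast)
qed

text \<open>If \<open>a\<close> is not in \<open>M\<close>, maximality puts 1 into the v-closure of
  a finite \<open>S\<close> inside \<open>M + R a\<close>. Scaling by \<open>b\<close> puts
  \<open>b\<close> into the v-closure of \<open>b S\<close>, and \<open>b S\<close> lies in
  \<open>M\<close> as soon as \<open>a * b\<close> does.\<close>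

lemma t_Max_prime:
  assumes M: "M \<in> t_Max R"
  shows "prime_ideal R M"
  unfolding prime_ideal_def
proof (intro conjI ballI impI)
  show "ideal R M" "M \<noteq> R" using t_MaxD[OF M] by auto
  fix a b assume ab: "a \<in> R" "b \<in> R" "a * b \<in> M"
  show "a \<in> M \<or> b \<in> M"
  proof (rule ccontr)
    assume n: "\<not> ?thesis"
    have sM: "submod R M" using t_MaxD[OF M] by auto
    obtain B where idB: "ideal R B" and MB: "M \<subseteq> B" and aB: "a \<in> B"
      and B_iff: "\<forall>x\<in>B. \<exists>m\<in>M. \<exists>r\<in>R. x = m + r * a"
      by (rule ideal_adjoin[OF t_MaxD(1)[OF M] ab(1)])
    have B0: "B \<noteq> {0}" using aB n submod_zero[OF sM] by blast
    have "1 \<in> t_op R B"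
    proof (rule ccontr)
      assume "1 \<notin> t_op R B"
      then obtain N where N: "N \<in> t_Max R" "B \<subseteq> N" using t_Max_above[OF idB B0] by blast
      then have "M \<subseteq> N" "a \<in> N" using MB aB by blast+
      moreover then have "N = M" using t_Max_maximal[OF M N(1)] by simp
      ultimately show False using n by blast
    qed
    then obtain S where S: "finite S" "S \<subseteq> B" "\<exists>s\<in>S. s \<noteq> 0" "1 \<in> vop R S"
      using idB unfolding ideal_def by (elim t_opE conjE)
    have "b * 1 \<in> vop R ((*) b ` S)" using S by (intro vop_scale)
    moreover have "(*) b ` S \<subseteq> M"
    proof
      fix x assume "x \<in> (*) b ` S"
      then obtain y where "y \<in> S" "x = b * y" by (rule imageE)
      moreover obtain m r where "m \<in> M" "r \<in> R" "y = m + r * a"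
        using bspec[OF B_iff subsetD[OF S(2) \<open>y \<in> S\<close>]] by (elim bexE)
      moreover then have "b * m + r * (a * b) \<in> M"
        using ab by (intro submod_add[OF sM submod_mult[OF sM] submod_mult[OF sM]])
      ultimately show "x \<in> M" by (simp add: algebra_simps)
    qed
    moreover have "b \<noteq> 0" using n submod_zero[OF sM] by blast
    ultimately have "b \<in> t_op R M" using S unfolding mem_t_op[OF sM]
      by (intro exI[of _ "(*) b ` S"]) auto
    then show False using n t_MaxD[OF M] by auto
  qed
qed

text \<open>Compactness device: "in no t-maximal ideal" becomes one finite subset with 1 in its
  v-closure. It is mostly applied to conductor ideals.\<close>

lemma t_Max_cover:
  assumes A: "ideal R A" "A \<noteq> {0}" and "\<And>M. M \<in> t_Max R \<Longrightarrow> \<not> A \<subseteq> M"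
  obtains S where "finite S" "S \<subseteq> A" "\<exists>s\<in>S. s \<noteq> 0" "1 \<in> vop R S"
proof -
  have "1 \<in> t_op R A" using t_Max_above[OF A] assms(3) by blast
  then show ?thesis using that A(1) unfolding ideal_def by (elim t_opE conjE)
qed

lemma t_Max_vop_one:
  assumes M: "M \<in> t_Max R" and S: "finite S" "\<exists>s\<in>S. s \<noteq> 0" "1 \<in> vop R S"
  shows "\<not> S \<subseteq> M"
proof
  assume "S \<subseteq> M"
  then have "1 \<in> t_op R M" using S mem_t_op[OF t_MaxD(2)[OF M]] by blast
  then show False using t_MaxD[OF M] ideal_eq_R by auto
qed

section \<open>Localization at a prime\<close>

lemma mem_loc: "0 \<in> P \<Longrightarrow> x \<in> loc R P \<longleftrightarrow> (\<exists>s\<in>R - P. s * x \<in> R)"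
  unfolding loc_def by (force simp: field_simps)

lemma mem_loc_prime: "prime_ideal R P \<Longrightarrow> x \<in> loc R P \<longleftrightarrow> (\<exists>s\<in>R - P. s * x \<in> R)"
  using mem_loc prime_idealD(5) by blast

lemma conductor_ideal: "submod R A \<Longrightarrow> ideal R {r\<in>R. r * x \<in> A}"
  by (auto simp: ideal_def submod_def distrib_right mult.assoc R_zero R_add R_mult)

text \<open>The ideal of denominators of \<open>x\<close> lies in no t-maximal ideal, so it contains
  a finite \<open>S\<close> with 1 in its v-closure. As \<open>x\<close> is in
  \<open>(R : S)\<close>, the product of \<open>x\<close> with 1 lies in \<open>R\<close>.\<close>

lemma Inter_loc:
  assumes "\<And>M. M \<in> t_Max R \<Longrightarrow> x \<in> loc R M"
  shows "x \<in> R"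
proof -
  let ?A = "{r\<in>R. r * x \<in> R}"
  obtain b where b: "b \<in> R" "b \<noteq> 0" "b * x \<in> R" by (rule denominator)
  obtain S where S: "S \<subseteq> ?A" "1 \<in> vop R S"
  proof (rule t_Max_cover)
    show "ideal R ?A" by (rule conductor_ideal[OF submod_R])
    show "?A \<noteq> {0}" using b by blast
    show "\<not> ?A \<subseteq> M" if "M \<in> t_Max R" for M
      using assms[OF that] mem_loc_prime[OF t_Max_prime[OF that]] by blast
  qed blast
  have "x \<in> colon R S" using S(1) by (auto simp: colon_def mult.commute)
  then show "x \<in> R" using S(2) by (auto simp: vop_def colon_def)
qed

text \<open>Otherwise \<open>Inter_loc\<close> would hold vacuously and give
  \<open>R = K\<close>.\<close>

lemma t_Max_nonempty: "t_Max R \<noteq> {}"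
  using Inter_loc dom unfolding domain_with_qf_def by blast

lemma loc_mult:
  assumes P: "prime_ideal R P" and "x \<in> loc R P" "y \<in> loc R P"
  shows "x * y \<in> loc R P"
proof -
  obtain s t where "s \<in> R - P" "s * x \<in> R" "t \<in> R - P" "t * y \<in> R"
    using assms mem_loc_prime[OF P] by blast
  moreover then have "s * t \<in> R - P" "(s * x) * (t * y) \<in> R"
    using prime_idealD(6)[OF P] R_mult by blast+
  ultimately show ?thesis
    unfolding mem_loc_prime[OF P] by (intro bexI[of _ "s * t"]) (simp_all add: algebra_simps)
qed

lemma R_subset_loc:
  assumes "prime_ideal R P" "x \<in> R"
  shows "x \<in> loc R P"
  unfolding mem_loc_prime[OF assms(1)]
proof
  show "1 * x \<in> R" using assms(2) by simp
  show "1 \<in> R - P" using prime_not_one[OF assms(1)] R_one by simp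
qed

lemma inverse_in_loc:
  assumes "prime_ideal R P" "s \<in> R - P"
  shows "inverse s \<in> loc R P"
proof -
  have "s \<noteq> 0" using assms(2) prime_idealD(5)[OF assms(1)] by auto
  then have "s * inverse s \<in> R" using R_one by simp
  then show ?thesis using assms(2) unfolding mem_loc_prime[OF assms(1)] by (intro bexI[of _ s])
qed

lemma submod_saturation:
  assumes P: "prime_ideal R P" and A: "submod R A"
  shows "submod (loc R P) {x. \<exists>s\<in>R - P. s * x \<in> A}"
  unfolding submod_def
proof (intro conjI ballI)
  show "0 \<in> {x. \<exists>s\<in>R - P. s * x \<in> A}"
    using submod_zero[OF A] prime_not_one[OF P] R_one by force
next
  fix x y assume "x \<in> {x. \<exists>s\<in>R - P. s * x \<in> A}" "y \<in> {x. \<exists>s\<in>R - P. s * x \<in> A}"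
  then obtain s t where st: "s \<in> R - P" "t \<in> R - P" "s * x \<in> A" "t * y \<in> A" by blast
  then have "s * t \<in> R - P" using prime_idealD(6)[OF P] R_mult by blast
  moreover have "t * (s * x) + s * (t * y) \<in> A"
    using st by (intro submod_add[OF A submod_mult[OF A] submod_mult[OF A]]) auto
  then have "(s * t) * (x + y) \<in> A" by (simp add: algebra_simps)
  ultimately show "x + y \<in> {x. \<exists>s\<in>R - P. s * x \<in> A}" by blast
next
  fix r x assume "r \<in> loc R P" "x \<in> {x. \<exists>s\<in>R - P. s * x \<in> A}"
  then obtain s t where st: "s \<in> R - P" "t \<in> R - P" "s * r \<in> R" "t * x \<in> A"
    using mem_loc_prime[OF P] by blast
  then have "s * t \<in> R - P" using prime_idealD(6)[OF P] R_mult by blast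
  moreover have "(s * r) * (t * x) \<in> A" using st by (intro submod_mult[OF A, of "s * r"])
  then have "(s * t) * (r * x) \<in> A" by (simp add: algebra_simps)
  ultimately show "r * x \<in> {x. \<exists>s\<in>R - P. s * x \<in> A}" by blast
qed

text \<open>One denominator suffices for an element of \<open>A R_P\<close>. This saturated form is
  the one in which \<open>wop\<close> and local modules are handled below.\<close>

lemma genmod_loc:
  assumes P: "prime_ideal R P" and A: "submod R A"
  shows "genmod (loc R P) A = {x. \<exists>s\<in>R - P. s * x \<in> A}"
proof
  show "genmod (loc R P) A \<subseteq> {x. \<exists>s\<in>R - P. s * x \<in> A}"
    using R_one prime_not_one[OF P]
    by (intro genmod_least submod_saturation[OF assms]) force
next
  show "{x. \<exists>s\<in>R - P. s * x \<in> A} \<subseteq> genmod (loc R P) A"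
  proof
    fix x assume "x \<in> {x. \<exists>s\<in>R - P. s * x \<in> A}"
    then obtain s where s: "s \<in> R - P" "s * x \<in> A" by blast
    then have "inverse s * (s * x) \<in> genmod (loc R P) A"
      using inverse_in_loc[OF P s(1)] genmod_superset[of A "loc R P"]
      by (intro submod_mult[OF submod_genmod, of "inverse s"]) auto
    moreover have "s \<noteq> 0" using s prime_idealD(5)[OF P] by blast
    ultimately show "x \<in> genmod (loc R P) A" by (simp add: mult.assoc[symmetric])
  qed
qed

section \<open>The w-operation and w-stability\<close>

lemma mem_wop:
  "submod R A \<Longrightarrow> x \<in> wop R A \<longleftrightarrow> (\<forall>M\<in>t_Max R. \<exists>s\<in>R - M. s * x \<in> A)"
  unfolding wop_def using genmod_loc[OF t_Max_prime] by auto

lemma wop_superset: "A \<subseteq> wop R A"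
  unfolding wop_def using genmod_superset by blast

lemma wop_mono: "submod R A \<Longrightarrow> submod R B \<Longrightarrow> A \<subseteq> B \<Longrightarrow> wop R A \<subseteq> wop R B"
  by (auto simp: mem_wop subset_iff) meson

lemma Eend_wop:
  assumes I: "submod R I" "wop R I = I"
  shows "wop R (Eend I) = Eend I"
proof
  have E: "submod R (Eend I)" unfolding Eend_def by (intro submod_colon I)
  show "wop R (Eend I) \<subseteq> Eend I"
  proof
    fix x assume x: "x \<in> wop R (Eend I)"
    have "x * i \<in> wop R I" if "i \<in> I" for i
      unfolding mem_wop[OF I(1)]
    proof
      fix M assume "M \<in> t_Max R"
      then obtain s where "s \<in> R - M" "s * x \<in> Eend I" using x unfolding mem_wop[OF E] by blast
      then show "\<exists>s\<in>R - M. s * (x * i) \<in> I"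
        using that by (intro bexI[of _ s]) (auto simp: Eend_def colon_def mult.assoc)
    qed
    then show "x \<in> Eend I" using I(2) by (simp add: Eend_def colon_def)
  qed
qed (rule wop_superset)

text \<open>The product \<open>I (E : I)\<close> always lies in \<open>E\<close>, which is w-closed.
  Conversely \<open>E\<close> multiplies \<open>(E : I)\<close> into itself, so 1 in the w-closure
  of the product brings all of \<open>E\<close> with it. Stability thus says that the product lies
  in no t-maximal ideal.\<close>

lemma w_stable_iff:
  assumes I: "submod R I" "wop R I = I"
  shows "w_stable R I \<longleftrightarrow> (\<forall>M\<in>t_Max R. \<exists>s\<in>R - M. s \<in> mprod R I (colon (Eend I) I))"
proof -
  let ?D = "mprod R I (colon (Eend I) I)"
  have E: "submod R (Eend I)" unfolding Eend_def by (intro submod_colon I)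
  have D: "submod R ?D" by (rule submod_mprod)
  have one: "1 \<in> Eend I" by (simp add: Eend_def colon_def)
  have "w_stable R I \<longleftrightarrow> 1 \<in> wop R ?D"
  proof
    assume "w_stable R I"
    then show "1 \<in> wop R ?D" using one by (simp add: w_stable_def)
  next
    assume D1: "1 \<in> wop R ?D"
    have "?D \<subseteq> Eend I"
      by (rule mprod_least[OF E]) (auto simp: colon_def mult.commute)
    then have "wop R ?D \<subseteq> Eend I" using wop_mono[OF D E] Eend_wop[OF I] by blast
    moreover have "e \<in> wop R ?D" if e: "e \<in> Eend I" for e
      unfolding mem_wop[OF D]
    proof
      fix M assume "M \<in> t_Max R"
      then obtain s where s: "s \<in> R - M" "s \<in> ?D" using D1 unfolding mem_wop[OF D] by auto
      have "e * s \<in> ?D"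
        using s(2) by (rule mprod_mult_right) (use e in \<open>auto simp: colon_def Eend_def mult.assoc\<close>)
      then show "\<exists>s\<in>R - M. s * e \<in> ?D" using s by (auto simp: mult.commute)
    qed
    ultimately show "w_stable R I" using I by (auto simp: w_stable_def w_ideal_def)
  qed
  then show ?thesis by (simp add: mem_wop[OF D])
qed

lemma loc_antimono: "P \<subseteq> M \<Longrightarrow> loc R M \<subseteq> loc R P"
  by (auto simp: loc_def)

lemma finite_common_denominator:
  assumes P: "prime_ideal R P" and "finite J" "\<And>j. j \<in> J \<Longrightarrow> f j \<in> loc R P"
  shows "\<exists>s\<in>R - P. \<forall>j\<in>J. s * f j \<in> R"
  using assms(2,3)
proof (induction J rule: finite_induct)
  case empty
  then show ?case using R_one prime_not_one[OF P] by blast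
next
  case (insert x F)
  obtain s where s: "s \<in> R - P" "\<forall>j\<in>F. s * f j \<in> R" using insert by auto
  obtain t where t: "t \<in> R - P" "t * f x \<in> R" using insert.prems[of x] mem_loc_prime[OF P] by auto
  have "s * t \<in> R - P" using s t prime_idealD(6)[OF P, of s t] R_mult by blast
  moreover have "s * t * f j \<in> R" if "j \<in> insert x F" for j
  proof (cases "j = x")
    case True
    then show ?thesis using s t R_mult[of s "t * f x"] by (simp add: mult.assoc)
  next
    case False
    then show ?thesis using s t that R_mult[of t "s * f j"] by (simp add: ac_simps)
  qed
  ultimately show ?case by blast
qed

text \<open>Krull's argument: an ideal maximal among those that miss a multiplicatively closed set
  is prime. The element \<open>s0\<close> makes \<open>S\<close> nonempty and hence \<open>Q\<close>
  proper.\<close>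

lemma prime_avoidance:
  assumes A: "ideal R A" and S: "S \<subseteq> R" "s0 \<in> S" "\<And>s t. s \<in> S \<Longrightarrow> t \<in> S \<Longrightarrow> s * t \<in> S"
    and "A \<inter> S = {}"
  obtains Q where "prime_ideal R Q" "A \<subseteq> Q" "Q \<inter> S = {}"
proof -
  let ?A = "{B. ideal R B \<and> A \<subseteq> B \<and> B \<inter> S = {}}"
  have "\<exists>M\<in>?A. \<forall>X\<in>?A. M \<subseteq> X \<longrightarrow> X = M"
  proof (rule subset_Zorn_nonempty)
    show "?A \<noteq> {}" using assms by blast
  next
    fix \<C> assume C: "\<C> \<noteq> {}" "subset.chain ?A \<C>"
    have "ideal R (\<Union>\<C>)"
      by (rule ideal_Union_chain[OF C(2) C(1)]) auto
    moreover have "A \<subseteq> \<Union>\<C>" using C by (force simp: subset.chain_def)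
    moreover have "\<Union>\<C> \<inter> S = {}" using C by (force simp: subset.chain_def)
    ultimately show "\<Union>\<C> \<in> ?A" by blast
  qed
  then obtain Q where "Q \<in> ?A" and max': "\<forall>X\<in>?A. Q \<subseteq> X \<longrightarrow> X = Q" by (rule bexE)
  then have Q: "ideal R Q" "A \<subseteq> Q" "Q \<inter> S = {}" by simp_all
  have sQ: "submod R Q" and QR: "Q \<subseteq> R" using Q by (auto simp: ideal_def)
  have meet: "\<exists>q\<in>Q. \<exists>r\<in>R. q + r * a \<in> S" if a: "a \<in> R" "a \<notin> Q" for a
  proof -
    obtain B where B: "ideal R B" "Q \<subseteq> B" "a \<in> B"
      and B_iff: "\<forall>x\<in>B. \<exists>m\<in>Q. \<exists>r\<in>R. x = m + r * a"
      by (rule ideal_adjoin[OF Q(1) a(1)])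
    have "B \<noteq> Q" using B a by blast
    then have "B \<notin> ?A" using bspec[OF max', of B] B(2) by blast
    then obtain x where x: "x \<in> B" "x \<in> S" using B Q by blast
    then show ?thesis using bspec[OF B_iff x(1)] by blast
  qed
  have "a \<in> Q \<or> b \<in> Q" if ab: "a \<in> R" "b \<in> R" "a * b \<in> Q" for a b
  proof (rule ccontr)
    assume n: "\<not> ?thesis"
    obtain q r where q: "q \<in> Q" "r \<in> R" "q + r * a \<in> S" using meet[of a] ab n by blast
    obtain q' r' where q': "q' \<in> Q" "r' \<in> R" "q' + r' * b \<in> S" using meet[of b] ab n by blast
    \<comment> \<open>If \<open>Q + R a\<close> and \<open>Q + R b\<close> both met
      \<open>S\<close>, this product of the two common elements would lie in \<open>Q\<close> and in
      \<open>S\<close>.\<close>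
    have "(q + r * a) * (q' + r' * b) = ((q' + r' * b) * q + (r * a) * q') + (r * r') * (a * b)"
      by (simp add: algebra_simps)
    moreover have "\<dots> \<in> Q"
      using q q' ab QR
      by (intro submod_add[OF sQ] submod_mult[OF sQ _ q(1)] submod_mult[OF sQ _ q'(1)]
          submod_mult[OF sQ _ ab(3)] R_mult R_add) auto
    ultimately show False using S(3)[OF q(3) q'(3)] Q(3) by auto
  qed
  moreover have "Q \<noteq> R" using Q S by blast
  ultimately have "prime_ideal R Q" using Q by (auto simp: prime_ideal_def)
  then show ?thesis using that Q by blast
qed

lemma t_primeD:
  assumes "t_prime R P"
  shows "prime_ideal R P" "t_op R P = P" "P \<noteq> {0}"
  using assms by (auto simp: t_prime_def t_ideal_def frac_ideal_def)

lemma t_prime_below_t_Max: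
  assumes "t_prime R P"
  obtains M where "M \<in> t_Max R" "P \<subseteq> M"
  using t_Max_above[of P] t_primeD[OF assms] prime_not_one[of P] prime_idealD(1)[of R P] by auto

lemma prime_nonzero_elt: "prime_ideal R P \<Longrightarrow> P \<noteq> {0} \<Longrightarrow> \<exists>p\<in>P. p \<noteq> 0"
  using prime_idealD(2) submod_nonzero by blast

lemma t_Max_t_prime: "M \<in> t_Max R \<Longrightarrow> t_prime R M"
  using t_MaxD(5) t_Max_prime by (auto simp: t_prime_def)

end

section \<open>Primes of a PvMD\<close>

locale pvmd = qf_domain +
  assumes pvmd: "PvMD R"
begin

text \<open>The valuation ring \<open>R_M\<close> contains \<open>1/x\<close>, as \<open>x\<close>
  is not in the larger ring \<open>R_P\<close>. The numerator of \<open>1/x\<close> must lie in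
  \<open>P\<close>, since otherwise it would serve as a denominator of \<open>x\<close> outside
  \<open>P\<close>.\<close>

lemma not_in_loc_prime:
  assumes P: "prime_ideal R P" and M: "M \<in> t_Max R" and "P \<subseteq> M" and x: "x \<notin> loc R P"
  obtains q s where "q \<in> P" "q \<noteq> 0" "s \<in> R - P" "x * q = s"
proof -
  have x0: "x \<noteq> 0" using x R_subset_loc[OF P R_zero] by blast
  have "x \<notin> loc R M" using x loc_antimono[OF \<open>P \<subseteq> M\<close>] by blast
  then have "inverse x \<in> loc R M" using pvmd M x0 by (auto simp: PvMD_def valuation_domain_def)
  then obtain s where s: "s \<in> R - M" "s * inverse x \<in> R"
    using mem_loc_prime[OF t_Max_prime[OF M]] by blast
  have s': "s \<in> R - P" using s \<open>P \<subseteq> M\<close> by blast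
  have eq: "x * (s * inverse x) = s" using x0 by simp
  have "s * inverse x \<in> P"
  proof (rule ccontr)
    assume "s * inverse x \<notin> P"
    then have "s * inverse x \<in> R - P" "(s * inverse x) * x \<in> R"
      using s eq by (simp_all only: mult.commute[of _ x]) auto
    then show False using x mem_loc_prime[OF P] by blast
  qed
  moreover have "s \<noteq> 0" using s' prime_idealD(5)[OF P] by blast
  ultimately show ?thesis using that[of "s * inverse x" s] s' eq x0 by auto
qed

text \<open>This is \<open>Q R_Q \<subseteq> R_N\<close>, a standard property of primes in valuation
  rings. If \<open>y * q\<close> were not in \<open>R_N\<close>, its inverse would be
  \<open>n / s\<close> with \<open>s\<close> outside \<open>N\<close>; clearing the denominator
  \<open>t\<close> of \<open>y\<close> gives \<open>t * s\<close> in \<open>Q\<close>, with neither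
  factor in \<open>Q\<close>.\<close>

lemma mult_prime_in_loc:
  assumes Q: "prime_ideal R Q" and N: "N \<in> t_Max R" and "Q \<subseteq> N" and y: "y \<in> loc R Q" and q: "q \<in> Q"
  shows "y * q \<in> loc R N"
proof (rule ccontr)
  assume "y * q \<notin> loc R N"
  then obtain n s where n: "n \<in> N" "s \<in> R - N" "y * q * n = s"
    using not_in_loc_prime[OF t_Max_prime[OF N] N] by blast
  obtain t where t: "t \<in> R - Q" "t * y \<in> R" using y mem_loc_prime[OF Q] by blast
  have "(t * y * n) * q \<in> Q"
    using n t_MaxD(3)[OF N] q
    by (intro submod_mult[OF prime_idealD(2)[OF Q]] R_mult[OF t(2)]) auto
  moreover have "(t * y * n) * q = t * s" using n(3) by (simp add: ac_simps)
  ultimately have "s \<in> Q" using prime_idealD(6)[OF Q, of t s] t n by auto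
  then show False using n \<open>Q \<subseteq> N\<close> by blast
qed

text \<open>With \<open>p\<close> in \<open>P\<close> outside \<open>Q\<close>, and \<open>q\<close>
  in \<open>Q\<close> outside \<open>P\<close>, the quotient \<open>q / p\<close> lies in
  \<open>Q R_Q \<subseteq> R_M\<close>. A denominator \<open>s\<close> outside \<open>M\<close> then
  gives \<open>s * q\<close> in \<open>P\<close>, although neither factor is.\<close>

lemma primes_comparable:
  assumes P: "prime_ideal R P" and Q: "prime_ideal R Q" and M: "M \<in> t_Max R" "P \<subseteq> M" "Q \<subseteq> M"
  shows "P \<subseteq> Q \<or> Q \<subseteq> P"
proof (rule ccontr)
  assume "\<not> ?thesis"
  then obtain p q where pq: "p \<in> P" "p \<notin> Q" "q \<in> Q" "q \<notin> P" by blast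
  have R: "p \<in> R" "q \<in> R" using pq prime_idealD(3)[OF P] prime_idealD(3)[OF Q] by auto
  have "inverse p \<in> loc R Q" using inverse_in_loc[OF Q] pq R by blast
  then have "inverse p * q \<in> loc R M" by (rule mult_prime_in_loc[OF Q M(1,3) _ pq(3)])
  then obtain s where s: "s \<in> R - M" "s * (inverse p * q) \<in> R"
    using mem_loc_prime[OF t_Max_prime[OF M(1)]] by blast
  have "p \<noteq> 0" using pq prime_idealD(5)[OF Q] by blast
  then have "s * q = (s * (inverse p * q)) * p" by simp
  also have "\<dots> \<in> P" by (rule submod_mult[OF prime_idealD(2)[OF P] s(2) pq(1)])
  finally have "s \<in> P" using prime_idealD(6)[OF P, of s q] s R pq by blast
  then show False using s M by blast
qed

text \<open>In a valuation ring one member \<open>a\<close> of a finite set divides all the others.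
  A common denominator \<open>s\<close> of the quotients satisfies \<open>s = a * (s / a)\<close>,
  so \<open>J (R : J)\<close> is not inside \<open>M\<close>.\<close>

lemma finite_local_generator:
  assumes J: "finite J" "\<exists>j\<in>J. j \<noteq> 0" and M: "M \<in> t_Max R"
  obtains a s where "a \<in> J" "a \<noteq> 0" "s \<in> R - M" "s / a \<in> colon R J"
proof -
  note MP = t_Max_prime[OF M]
  \<comment> \<open>Zero is set aside because generators are compared by quotients; it returns at
    the end through \<open>0 / a = 0\<close>.\<close>
  have "finite (J - {0})" "J - {0} \<noteq> {}" using J by auto
  then have "\<exists>a\<in>J - {0}. \<forall>j\<in>J - {0}. j / a \<in> loc R M"
  proof (induction "J - {0}" arbitrary: J rule: finite_ne_induct)
    case (singleton x)
    then have "x \<noteq> 0" by blast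
    then show ?case using singleton R_subset_loc[OF MP R_one] by (metis divide_self singletonD singletonI)
  next
    case (insert x F)
    have x0: "x \<noteq> 0" and F: "F = F - {0}" using insert by blast+
    then obtain a where a: "a \<in> F" "a \<noteq> 0" "\<And>j. j \<in> F \<Longrightarrow> j / a \<in> loc R M"
      using insert(4)[of F] by blast
    show ?case
    proof (cases "x / a \<in> loc R M")
      case True
      then have "\<forall>j\<in>insert x F. j / a \<in> loc R M" using a by blast
      then show ?thesis using a(1) insert(5) by blast
    next
      case False
      moreover have "x / a \<noteq> 0" using x0 a by simp
      ultimately have "inverse (x / a) \<in> loc R M"
        using pvmd M unfolding PvMD_def valuation_domain_def by blast
      then have ax: "a / x \<in> loc R M" by (simp add: inverse_eq_divide)
      have "j / x \<in> loc R M" if "j \<in> insert x F" for j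
      proof (cases "j = x")
        case True
        then show ?thesis using x0 R_subset_loc[OF MP R_one] by simp
      next
        case False
        then have "(j / a) * (a / x) \<in> loc R M" using that a(3) ax by (intro loc_mult[OF MP]) auto
        then show ?thesis using a(2) by simp
      qed
      then show ?thesis using insert(5) by blast
    qed
  qed
  then obtain a where a: "a \<in> J" "a \<noteq> 0" "\<And>j. j \<in> J - {0} \<Longrightarrow> j / a \<in> loc R M" by blast
  then have "j / a \<in> loc R M" if "j \<in> J" for j
    using that R_subset_loc[OF MP R_zero] by (cases "j = 0") auto
  then obtain s where s: "s \<in> R - M" "\<forall>j\<in>J. s * (j / a) \<in> R"
    using finite_common_denominator[OF MP J(1), of "\<lambda>j. j / a"] by blast
  then have "s / a \<in> colon R J" by (simp add: colon_def)
  then show ?thesis using that a s by blast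
qed

text \<open>If \<open>x\<close> is in the v-closure of \<open>S\<close> and \<open>a\<close>
  generates \<open>S\<close> locally at \<open>M\<close>, then \<open>x * (s / a)\<close> lies in
  \<open>R\<close>, so \<open>s * x\<close> lies in \<open>R a\<close>. Conversely the conductor of
  \<open>x\<close> into \<open>A\<close> lies in no t-maximal ideal, and scaling the finite witness
  by \<open>x\<close> moves it into \<open>A\<close>.\<close>

lemma t_op_eq_wop:
  assumes A: "submod R A" "A \<noteq> {0}"
  shows "t_op R A = wop R A"
proof
  show "t_op R A \<subseteq> wop R A"
  proof
    fix x assume "x \<in> t_op R A"
    then obtain S where S: "finite S" "S \<subseteq> A" "\<exists>s\<in>S. s \<noteq> 0" "x \<in> vop R S"
      using A(1) by (rule t_opE)
    show "x \<in> wop R A"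
      unfolding mem_wop[OF A(1)]
    proof
      fix M assume M: "M \<in> t_Max R"
      then obtain a s where a: "a \<in> S" "a \<noteq> 0" "s \<in> R - M" "s / a \<in> colon R S"
        using finite_local_generator[OF S(1,3)] by blast
      then have "x * (s / a) \<in> R" using vop_colon[OF S(4)] by blast
      then have "x * (s / a) * a \<in> A" using submod_mult[OF A(1)] a S(2) by blast
      then have "s * x \<in> A" using a(2) by (simp add: mult.commute)
      then show "\<exists>s\<in>R - M. s * x \<in> A" using a(3) by blast
    qed
  qed
next
  show "wop R A \<subseteq> t_op R A"
  proof
    fix x assume x: "x \<in> wop R A"
    show "x \<in> t_op R A"
    \<comment> \<open>Scaling by zero would leave no nonzero element, which \<open>mem_t_op\<close>
      requires.\<close>
    proof (cases "x = 0")
      case True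
      then show ?thesis using submod_zero[OF submod_t_op[OF A]] by simp
    next
      case False
      let ?B = "{r\<in>R. r * x \<in> A}"
      have nsub: "\<not> ?B \<subseteq> M" if "M \<in> t_Max R" for M
        using x that unfolding mem_wop[OF A(1)] by blast
      obtain M where M: "M \<in> t_Max R" using t_Max_nonempty by blast
      have "?B \<noteq> {0}"
      proof
        assume eq: "?B = {0}"
        show False using nsub[OF M] submod_zero[OF t_MaxD(2)[OF M]] unfolding eq by simp
      qed
      then obtain S where S: "finite S" "S \<subseteq> ?B" "\<exists>s\<in>S. s \<noteq> 0" "1 \<in> vop R S"
        using t_Max_cover[OF conductor_ideal[OF A(1)] _ nsub] by blast
      have "x * 1 \<in> vop R ((*) x ` S)" by (rule vop_scale[OF S(4)])
      moreover have "(*) x ` S \<subseteq> A" using S(2) by (auto simp: mult.commute)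
      moreover have "\<exists>s\<in>(*) x ` S. s \<noteq> 0" using S(3) False by auto
      ultimately show ?thesis using S(1) unfolding mem_t_op[OF A(1)]
        by (intro exI[of _ "(*) x ` S"]) auto
    qed
  qed
qed

lemma wop_subset_R:
  assumes A: "submod R A" "A \<subseteq> R"
  shows "wop R A \<subseteq> R"
proof
  fix x assume "x \<in> wop R A"
  then have "wop R A \<subseteq> wop R R \<Longrightarrow> x \<in> loc R M" if "M \<in> t_Max R" for M
    using that mem_wop[OF submod_R] mem_loc_prime[OF t_Max_prime[OF that]] by blast
  then show "x \<in> R" using Inter_loc wop_mono[OF A(1) submod_R A(2)] by blast
qed

text \<open>A denominator outside \<open>M\<close> is outside \<open>P\<close> and can be cancelled
  by primality, so \<open>P\<close> is w-closed and hence t-closed. This is how primes constructed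
  algebraically are recognized as t-primes.\<close>

lemma t_primeI:
  assumes P: "prime_ideal R P" "P \<noteq> {0}" and M: "M \<in> t_Max R" "P \<subseteq> M"
  shows "t_prime R P"
proof -
  note sP = prime_idealD(2)[OF P(1)]
  have "wop R P \<subseteq> P"
  proof
    fix x assume x: "x \<in> wop R P"
    then obtain s where s: "s \<in> R - M" "s * x \<in> P" using M(1) unfolding mem_wop[OF sP] by blast
    have "x \<in> R" using x wop_subset_R[OF sP prime_idealD(3)[OF P(1)]] by blast
    then show "x \<in> P" using s prime_idealD(6)[OF P(1), of s x] M by blast
  qed
  then have "t_op R P = P" using t_op_eq_wop[OF sP P(2)] wop_superset[of P] by blast
  then show ?thesis unfolding t_prime_def using P t_idealI prime_idealD(1) by blast
qed

section \<open>Radical t-ideals\<close>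

abbreviation radical_t_ideal :: "'a set \<Rightarrow> bool" where
  "radical_t_ideal I \<equiv> radical_ideal R I \<and> t_ideal R I"

text \<open>The value is \<open>R\<close> when no t-prime contains \<open>S\<close>. Arbitrary sets
  are allowed so that an ideal can be described, up to radical, by a finite subset.\<close>

definition t_radical :: "'a set \<Rightarrow> 'a set" where
  "t_radical S = {x\<in>R. \<forall>Q. t_prime R Q \<and> S \<subseteq> Q \<longrightarrow> x \<in> Q}"

lemma t_radical_superset: "S \<subseteq> R \<Longrightarrow> S \<subseteq> t_radical S"
  by (auto simp: t_radical_def)

lemma t_radical_subset_R: "t_radical S \<subseteq> R"
  by (auto simp: t_radical_def)

lemma t_radical_mono: "S \<subseteq> S' \<Longrightarrow> t_radical S \<subseteq> t_radical S'"
  by (auto simp: t_radical_def)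

lemma t_radical_subset_prime: "t_prime R Q \<Longrightarrow> S \<subseteq> Q \<Longrightarrow> t_radical S \<subseteq> Q"
  by (auto simp: t_radical_def)

lemma t_radicalI: "x \<in> R \<Longrightarrow> (\<And>Q. t_prime R Q \<Longrightarrow> S \<subseteq> Q \<Longrightarrow> x \<in> Q) \<Longrightarrow> x \<in> t_radical S"
  by (auto simp: t_radical_def)

lemma t_prime_power:
  assumes "t_prime R Q" "x \<in> R" "x ^ n \<in> Q"
  shows "x \<in> Q"
  using assms(3)
proof (induction n)
  case 0
  then show ?case using prime_not_one[OF t_primeD(1)[OF assms(1)]] by simp
next
  case (Suc n)
  then show ?case
    using prime_idealD(6)[OF t_primeD(1)[OF assms(1)], of x "x ^ n"] R_power[OF assms(2)] assms(2) by auto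
qed

lemma t_prime_radical:
  assumes "t_prime R P"
  shows "radical_t_ideal P"
proof
  show "radical_ideal R P"
    unfolding radical_ideal_def
    using prime_idealD(1)[OF t_primeD(1)[OF assms]] t_prime_power[OF assms] by blast
  show "t_ideal R P" using assms by (simp add: t_prime_def)
qed

lemma t_radical_ideal: "ideal R (t_radical S)"
  unfolding ideal_def submod_def
proof (intro conjI ballI t_radical_subset_R)
  show "0 \<in> t_radical S"
    using R_zero prime_idealD(5)[OF t_primeD(1)] by (intro t_radicalI)
next
  fix a b assume ab: "a \<in> t_radical S" "b \<in> t_radical S"
  show "a + b \<in> t_radical S"
  proof (rule t_radicalI)
    show "a + b \<in> R" using ab t_radical_subset_R R_add by blast
    fix Q assume Q: "t_prime R Q" "S \<subseteq> Q"
    then show "a + b \<in> Q"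
      using ab t_radical_subset_prime[OF Q] submod_add[OF prime_idealD(2)[OF t_primeD(1)[OF Q(1)]]] by blast
  qed
next
  fix r a assume ab: "r \<in> R" "a \<in> t_radical S"
  show "r * a \<in> t_radical S"
  proof (rule t_radicalI)
    show "r * a \<in> R" using ab t_radical_subset_R R_mult by blast
    fix Q assume Q: "t_prime R Q" "S \<subseteq> Q"
    then show "r * a \<in> Q"
      using ab t_radical_subset_prime[OF Q] submod_mult[OF prime_idealD(2)[OF t_primeD(1)[OF Q(1)]]] by blast
  qed
qed

lemma t_radical_radical_t_ideal:
  assumes S: "S \<subseteq> R" "\<exists>s\<in>S. s \<noteq> 0"
  shows "radical_t_ideal (t_radical S)"
proof
  show "radical_ideal R (t_radical S)"
    unfolding radical_ideal_def
  proof (intro conjI ballI impI t_radical_ideal)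
    fix x assume x: "x \<in> R" "\<exists>n>0. x ^ n \<in> t_radical S"
    then obtain n where n: "x ^ n \<in> t_radical S" by blast
    show "x \<in> t_radical S"
    proof (rule t_radicalI[OF x(1)])
      fix Q assume Q: "t_prime R Q" "S \<subseteq> Q"
      then have "x ^ n \<in> Q" using n t_radical_subset_prime by blast
      then show "x \<in> Q" by (rule t_prime_power[OF Q(1) x(1)])
    qed
  qed
  have ne: "t_radical S \<noteq> {0}" using S t_radical_superset[OF S(1)] by blast
  have sub: "submod R (t_radical S)" using t_radical_ideal by (simp add: ideal_def)
  show "t_ideal R (t_radical S)"
  proof (rule t_idealI[OF t_radical_ideal ne])
    have "t_op R (t_radical S) \<subseteq> t_radical S"
    proof
      fix x assume x: "x \<in> t_op R (t_radical S)"
      show "x \<in> t_radical S"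
      proof (rule t_radicalI)
        show "x \<in> R" using x t_op_mono[OF t_radical_subset_R, of R S] t_op_R by blast
        fix Q assume Q: "t_prime R Q" "S \<subseteq> Q"
        show "x \<in> Q" using x t_op_mono[OF t_radical_subset_prime[OF Q], of R] t_primeD(2)[OF Q(1)] by blast
      qed
    qed
    then show "t_op R (t_radical S) = t_radical S" using t_op_superset[OF sub ne] by blast
  qed
qed

text \<open>For \<open>x\<close> outside \<open>I = I_w\<close> some \<open>M\<close> has no
  \<open>s\<close> outside it with \<open>s * x\<close> in \<open>I\<close>. Since \<open>I\<close>
  is radical, it misses all products \<open>s * x ^ n\<close>. A prime over \<open>I\<close>
  avoiding these products lies in \<open>M\<close> (exponent 0), is therefore a t-prime, and omits
  \<open>x\<close>.\<close>

lemma t_radical_eq: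
  assumes I: "radical_ideal R I" "t_ideal R I"
  shows "t_radical I = I"
proof
  have id: "ideal R I" "submod R I" "I \<subseteq> R" "I \<noteq> {0}" "t_op R I = I"
    using I by (auto simp: radical_ideal_def ideal_def t_ideal_def frac_ideal_def)
  show "I \<subseteq> t_radical I" by (rule t_radical_superset[OF id(3)])
  show "t_radical I \<subseteq> I"
  proof
    fix x assume x: "x \<in> t_radical I"
    have xR: "x \<in> R" using x t_radical_subset_R by blast
    show "x \<in> I"
    proof (rule ccontr)
      assume "x \<notin> I"
      then have "x \<notin> wop R I" using id t_op_eq_wop[OF id(2,4)] by simp
      then obtain M where M: "M \<in> t_Max R" and nI: "\<forall>s\<in>R - M. s * x \<notin> I"
        unfolding mem_wop[OF id(2)] by blast
      note MP = t_Max_prime[OF M]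
      define S where "S = {s * x ^ n | s n. s \<in> R - M}"
      have SI: "s * x ^ n \<in> S" if "s \<in> R - M" for s n using that unfolding S_def by blast
      obtain Q where Q: "prime_ideal R Q" "I \<subseteq> Q" "Q \<inter> S = {}"
      proof (rule prime_avoidance[OF id(1)])
        show "S \<subseteq> R" unfolding S_def using xR by (auto intro: R_mult R_power)
        show "1 * x ^ 0 \<in> S" using prime_not_one[OF MP] R_one by (intro SI) auto
        fix u v assume "u \<in> S" "v \<in> S"
        then obtain s n t m where st: "s \<in> R - M" "t \<in> R - M" "u = s * x ^ n" "v = t * x ^ m"
          unfolding S_def by blast
        then have "u * v = (s * t) * x ^ (n + m)" by (simp add: power_add)
        moreover have "s * t \<in> R - M" using st prime_idealD(6)[OF MP, of s t] R_mult by blast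
        ultimately show "u * v \<in> S" using SI by simp
      next
        show "I \<inter> S = {}"
        proof (rule ccontr)
          assume "I \<inter> S \<noteq> {}"
          then obtain s n where s: "s \<in> R - M" "s * x ^ n \<in> I" unfolding S_def by blast
          \<comment> \<open>The exponent is raised to \<open>Suc n\<close> so that it is positive
            even for \<open>n = 0\<close>, as \<open>radical_ideal\<close> demands.\<close>
          have "(s ^ n * x) * (s * x ^ n) \<in> I"
            using s xR by (intro submod_mult[OF id(2) _ s(2)] R_mult R_power) auto
          then have "(s * x) ^ Suc n \<in> I" by (simp add: power_mult_distrib ac_simps)
          then have "s * x \<in> I" using I(1) s xR R_mult unfolding radical_ideal_def by blast
          then show False using nI s by blast
        qed
      qed
      have "Q \<subseteq> M"
      proof
        fix q assume q: "q \<in> Q"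
        show "q \<in> M"
        proof (rule ccontr)
          assume "q \<notin> M"
          then have "q * x ^ 0 \<in> S" using q prime_idealD(3)[OF Q(1)] by (intro SI) auto
          then show False using q Q by auto
        qed
      qed
      moreover have "Q \<noteq> {0}" using Q(2) id submod_zero[OF id(2)] by blast
      ultimately have "t_prime R Q" using t_primeI[OF Q(1) _ M] by blast
      then have "x \<in> Q" using x Q(2) t_radical_subset_prime by blast
      moreover have "1 * x ^ 1 \<in> S" using prime_not_one[OF MP] R_one by (intro SI) auto
      ultimately show False using Q(3) by auto
    qed
  qed
qed

lemma radical_t_ideal_Union_chain:
  assumes C: "\<C> \<noteq> {}" "subset.chain \<A> \<C>" and A: "\<And>A. A \<in> \<A> \<Longrightarrow> radical_t_ideal A"
  shows "radical_t_ideal (\<Union>\<C>)"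
proof
  have rt: "radical_t_ideal B" if "B \<in> \<C>" for B
    using that A C(2) unfolding subset.chain_def by blast
  have id: "ideal R (\<Union>\<C>)"
    by (rule ideal_Union_chain[OF C(2) C(1)]) (use A in \<open>simp add: radical_ideal_def\<close>)
  show "radical_ideal R (\<Union>\<C>)"
    unfolding radical_ideal_def
  proof (intro conjI ballI impI id)
    fix x assume "x \<in> R" "\<exists>n>0. x ^ n \<in> \<Union>\<C>"
    then show "x \<in> \<Union>\<C>" using rt unfolding radical_ideal_def by blast
  qed
  obtain B where B: "B \<in> \<C>" using C by blast
  have ne: "\<Union>\<C> \<noteq> {0}"
  proof -
    have "submod R B" "B \<noteq> {0}" using rt[OF B] by (auto simp: t_ideal_def frac_ideal_def)
    then show ?thesis using B submod_nonzero by blast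
  qed
  have sub: "submod R (\<Union>\<C>)" using id by (simp add: ideal_def)
  show "t_ideal R (\<Union>\<C>)"
  proof (rule t_idealI[OF id ne])
    have "t_op R (\<Union>\<C>) \<subseteq> \<Union>\<C>"
    proof
      fix x assume "x \<in> t_op R (\<Union>\<C>)"
      then obtain S where S: "finite S" "S \<subseteq> \<Union>\<C>" "\<exists>s\<in>S. s \<noteq> 0" "x \<in> vop R S"
        using sub by (rule t_opE)
      obtain B where B: "B \<in> \<C>" "S \<subseteq> B"
        using finite_subset_Union_chain[OF S(1,2) C] by blast
      have tB: "submod R B" "t_op R B = B" using rt[OF B(1)] by (auto simp: t_ideal_def frac_ideal_def)
      have "x \<in> t_op R B" unfolding mem_t_op[OF tB(1)] using S B by (intro exI[of _ S]) simp
      then show "x \<in> \<Union>\<C>" using tB B by blast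
    qed
    then show "t_op R (\<Union>\<C>) = \<Union>\<C>" using t_op_superset[OF sub ne] by blast
  qed
qed

lemma radical_t_idealD:
  assumes "radical_t_ideal A"
  shows "ideal R A" "submod R A" "A \<subseteq> R" "\<exists>a\<in>A. a \<noteq> 0" "t_radical A = A"
  using assms t_radical_eq submod_nonzero[of R A]
  by (auto simp: radical_ideal_def ideal_def t_ideal_def frac_ideal_def)

lemma radical_t_ideal_insert:
  assumes A: "radical_t_ideal A" and "a \<in> R" "a \<notin> A"
  shows "radical_t_ideal (t_radical (insert a A))" "A \<subset> t_radical (insert a A)"
proof -
  have "insert a A \<subseteq> R" using assms radical_t_idealD(3)[OF A] by blast
  then show "radical_t_ideal (t_radical (insert a A))" "A \<subset> t_radical (insert a A)"
    using t_radical_superset[of "insert a A"] t_radical_radical_t_ideal[of "insert a A"]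
      radical_t_idealD(4)[OF A] assms by auto
qed

text \<open>As in Cohen's theorem, a radical t-ideal maximal among those not finitely generated up
  to t-radical turns out to be prime, against \<open>fin\<close>. Once all radical t-ideals are
  finitely generated in this sense, a finite set generating the union of a chain lies in one member,
  where the chain stops.\<close>

lemma acc_radical_tI:
  assumes fin: "\<And>P. t_prime R P \<Longrightarrow> \<exists>J. finite J \<and> J \<subseteq> P \<and> P \<subseteq> t_radical J"
  shows "acc_radical_t R"
proof -
  define bad where "bad = {A. radical_t_ideal A \<and> \<not> (\<exists>J. finite J \<and> J \<subseteq> A \<and> A \<subseteq> t_radical J)}"
  have badI: "A \<in> bad" if "radical_t_ideal A" "\<And>J. finite J \<Longrightarrow> J \<subseteq> A \<Longrightarrow> A \<subseteq> t_radical J \<Longrightarrow> False" for A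
    using that unfolding bad_def by blast
  have badD: "radical_t_ideal A" if "A \<in> bad" for A using that by (simp add: bad_def)
  have badD2: False if "A \<in> bad" "finite J" "J \<subseteq> A" "A \<subseteq> t_radical J" for A J
    using that unfolding bad_def by blast
  have "bad = {}"
  proof (rule ccontr)
    assume "bad \<noteq> {}"
    then have "\<exists>P\<in>bad. \<forall>X\<in>bad. P \<subseteq> X \<longrightarrow> X = P"
    proof (rule subset_Zorn_nonempty)
      fix \<C> assume C: "\<C> \<noteq> {}" "subset.chain bad \<C>"
      show "\<Union>\<C> \<in> bad"
      proof (rule badI)
        show "radical_t_ideal (\<Union>\<C>)" by (rule radical_t_ideal_Union_chain[OF C]) (rule badD)
        fix J assume J: "finite J" "J \<subseteq> \<Union>\<C>" "\<Union>\<C> \<subseteq> t_radical J"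
        obtain B where B: "B \<in> \<C>" "J \<subseteq> B" using finite_subset_Union_chain[OF J(1,2) C] by blast
        have "B \<in> bad" using B C(2) unfolding subset.chain_def by blast
        moreover have "B \<subseteq> t_radical J" using B(1) J(3) by blast
        ultimately show False using badD2 J B by blast
      qed
    qed
    then obtain P where P: "P \<in> bad" and max: "\<forall>X\<in>bad. P \<subseteq> X \<longrightarrow> X = P" by (rule bexE)
    note rP = badD[OF P]
    note PD = radical_t_idealD[OF rP]
    have gen: "\<exists>J. finite J \<and> J \<subseteq> t_radical (insert a P) \<and> t_radical (insert a P) \<subseteq> t_radical J"
      if a: "a \<in> R" "a \<notin> P" for a
    proof (rule ccontr)
      assume "\<not> ?thesis"
      then have "t_radical (insert a P) \<in> bad"
        using radical_t_ideal_insert(1)[OF rP a] unfolding bad_def by blast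
      then show False using bspec[OF max] radical_t_ideal_insert(2)[OF rP a] by blast
    qed
    have "P \<noteq> R"
    proof
      assume "P = R"
      have "R \<subseteq> t_radical {1}"
        using prime_not_one[OF t_primeD(1)] by (auto simp: t_radical_def)
      then show False using badD2[OF P, of "{1}"] \<open>P = R\<close> R_one by simp
    qed
    moreover have "a \<in> P \<or> b \<in> P" if ab: "a \<in> R" "b \<in> R" "a * b \<in> P" for a b
    proof (rule ccontr)
      assume n: "\<not> ?thesis"
      obtain J where J: "finite J" "J \<subseteq> t_radical (insert a P)" "t_radical (insert a P) \<subseteq> t_radical J"
        using gen[of a] ab n by blast
      obtain J' where J': "finite J'" "J' \<subseteq> t_radical (insert b P)" "t_radical (insert b P) \<subseteq> t_radical J'"
        using gen[of b] ab n by blast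
      have JR: "J \<subseteq> R" "J' \<subseteq> R" using J(2) J'(2) t_radical_subset_R by blast+
      have aPR: "insert a P \<subseteq> R" "insert b P \<subseteq> R" using ab PD(3) by auto
      \<comment> \<open>A t-prime over \<open>P\<close> contains \<open>a\<close> or
        \<open>b\<close>, hence \<open>J\<close> or \<open>J'\<close>, hence \<open>L\<close>; a
        t-prime over \<open>L\<close> contains \<open>J\<close> or \<open>J'\<close>, hence
        \<open>P\<close>. So the pairwise products generate \<open>P\<close> up to
        t-radical.\<close>
      define L where "L = (\<lambda>(x, y). x * y) ` (J \<times> J')"
      have LI: "x * y \<in> L" if "x \<in> J" "y \<in> J'" for x y using that unfolding L_def by force
      have "finite L" using J J' unfolding L_def by blast
      moreover have "L \<subseteq> P"
      proof
        fix z assume "z \<in> L"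
        then obtain x y where xy: "x \<in> J" "y \<in> J'" "z = x * y" unfolding L_def by auto
        have "z \<in> t_radical P"
        proof (rule t_radicalI)
          show "z \<in> R" using xy JR R_mult by blast
          fix Q assume Q: "t_prime R Q" "P \<subseteq> Q"
          note Qp = t_primeD(1)[OF Q(1)]
          have "a \<in> Q \<or> b \<in> Q" using prime_idealD(6)[OF Qp ab(1,2)] ab(3) Q(2) by blast
          then show "z \<in> Q"
          proof
            assume "a \<in> Q"
            then have "x \<in> Q" using t_radical_subset_prime[OF Q(1), of "insert a P"] Q(2) J(2) xy by blast
            then have "y * x \<in> Q" using submod_mult[OF prime_idealD(2)[OF Qp], of y x] xy JR by blast
            then show ?thesis using xy by (simp add: mult.commute)
          next
            assume "b \<in> Q"
            then have "y \<in> Q" using t_radical_subset_prime[OF Q(1), of "insert b P"] Q(2) J'(2) xy by blast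
            then show ?thesis using submod_mult[OF prime_idealD(2)[OF Qp], of x y] xy JR by blast
          qed
        qed
        then show "z \<in> P" using PD(5) by simp
      qed
      moreover have "P \<subseteq> t_radical L"
      proof
        fix p assume p: "p \<in> P"
        show "p \<in> t_radical L"
        proof (rule t_radicalI)
          show "p \<in> R" using p PD(3) by blast
          fix Q assume Q: "t_prime R Q" "L \<subseteq> Q"
          note Qp = t_primeD(1)[OF Q(1)]
          have "J \<subseteq> Q \<or> J' \<subseteq> Q"
          proof (rule ccontr)
            assume "\<not> ?thesis"
            then obtain x y where xy: "x \<in> J" "y \<in> J'" "x \<notin> Q" "y \<notin> Q" by blast
            then have "x * y \<in> Q" using LI Q(2) by blast
            then show False using prime_idealD(6)[OF Qp, of x y] xy JR by blast
          qed
          then have "t_radical J \<subseteq> Q \<or> t_radical J' \<subseteq> Q" using t_radical_subset_prime[OF Q(1)] by blast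
          then show "p \<in> Q"
            using p J(3) J'(3) t_radical_superset[OF aPR(1)] t_radical_superset[OF aPR(2)] by blast
        qed
      qed
      ultimately show False using badD2[OF P] by blast
    qed
    ultimately have "prime_ideal R P" using PD(1) by (simp add: prime_ideal_def)
    then have "t_prime R P" using rP by (simp add: t_prime_def)
    then show False using fin[of P] badD2[OF P] by blast
  qed
  then have good: "\<exists>J. finite J \<and> J \<subseteq> A \<and> A \<subseteq> t_radical J" if "radical_t_ideal A" for A
    using that unfolding bad_def by blast
  show ?thesis
    unfolding acc_radical_t_def
  proof (intro allI impI, elim conjE)
    fix f :: "nat \<Rightarrow> 'a set"
    assume rt: "\<forall>n. radical_t_ideal (f n)" and step: "\<forall>n. f n \<subseteq> f (Suc n)"
    have mono: "f m \<subseteq> f n" if "m \<le> n" for m n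
      using lift_Suc_mono_le[of f m n] step that by blast
    have ch: "subset.chain (range f) (range f)"
      unfolding subset_chain_def using mono nat_le_linear by blast
    have "radical_t_ideal (\<Union>(range f))"
      by (rule radical_t_ideal_Union_chain[OF _ ch]) (use rt in auto)
    then obtain J where J: "finite J" "J \<subseteq> \<Union>(range f)" "\<Union>(range f) \<subseteq> t_radical J"
      using good by blast
    obtain N where N: "J \<subseteq> f N"
      using finite_subset_Union_chain[OF J(1,2) _ ch] by blast
    have "f n = f N" if "n \<ge> N" for n
    proof
      have "f n \<subseteq> t_radical J" using J(3) by blast
      also have "\<dots> \<subseteq> t_radical (f N)" by (rule t_radical_mono[OF N])
      also have "\<dots> = f N" using radical_t_idealD(5) rt by blast
      finally show "f n \<subseteq> f N" .
    qed (rule mono[OF that])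
    then show "\<exists>N. \<forall>n\<ge>N. f n = f N" by blast
  qed
qed

section \<open>Consequences of the chain condition\<close>

lemma acc_radical_t_wf:
  assumes "acc_radical_t R"
  shows "wf {(B, A). radical_t_ideal A \<and> radical_t_ideal B \<and> A \<subset> B}"
  unfolding wf_iff_no_infinite_down_chain
proof
  assume "\<exists>f. \<forall>i. (f (Suc i), f i) \<in> {(B, A). radical_t_ideal A \<and> radical_t_ideal B \<and> A \<subset> B}"
  then obtain f where "\<forall>i. (f (Suc i), f i) \<in> {(B, A). radical_t_ideal A \<and> radical_t_ideal B \<and> A \<subset> B}"
    by (rule exE)
  then have f: "\<forall>i. radical_t_ideal (f i)" "\<forall>i. f i \<subset> f (Suc i)" by auto
  then have "\<forall>i. f i \<subseteq> f (Suc i)" by blast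
  then obtain N where N: "\<forall>n\<ge>N. f n = f N"
    using assms f(1) unfolding acc_radical_t_def by blast
  have "f (Suc N) = f N" using spec[OF N, of "Suc N"] by simp
  then show False using f(2) by blast
qed

text \<open>Among the t-radicals of finite subsets of \<open>D\<close> a maximal one cannot grow
  when a further element of \<open>D\<close> is adjoined. Keeping the nonzero \<open>d\<close> in
  every \<open>F\<close> ensures that these t-radicals are nonzero and so are t-ideals.\<close>

lemma acc_finite_t_radical:
  assumes acc: "acc_radical_t R" and D: "D \<subseteq> R" "d \<in> D" "d \<noteq> 0"
  obtains F where "finite F" "F \<subseteq> D" "D \<subseteq> t_radical F"
proof -
  define X where "X = {t_radical F | F. finite F \<and> F \<subseteq> D \<and> d \<in> F}"
  have "t_radical {d} \<in> X" using D unfolding X_def by blast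
  then obtain A where A: "A \<in> X"
    and max: "\<forall>B. (B, A) \<in> {(B, A). radical_t_ideal A \<and> radical_t_ideal B \<and> A \<subset> B} \<longrightarrow> B \<notin> X"
    by (rule wfE_min[OF acc_radical_t_wf[OF acc]]) blast
  then obtain F where F: "finite F" "F \<subseteq> D" "d \<in> F" "A = t_radical F" unfolding X_def by blast
  have "D \<subseteq> t_radical F"
  proof
    fix x assume x: "x \<in> D"
    have R: "F \<subseteq> R" "insert x F \<subseteq> R" using x F D by auto
    have "t_radical (insert x F) \<in> X" using x F unfolding X_def by blast
    moreover have "radical_t_ideal (t_radical F)" "radical_t_ideal (t_radical (insert x F))"
      using t_radical_radical_t_ideal[OF R(1)] t_radical_radical_t_ideal[OF R(2)] F D by blast+
    moreover have "t_radical F \<subseteq> t_radical (insert x F)" by (rule t_radical_mono) blast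
    ultimately have "t_radical (insert x F) = t_radical F" using max F(4) by blast
    then show "x \<in> t_radical F" using t_radical_superset[OF R(2)] by blast
  qed
  then show ?thesis using that F by blast
qed

text \<open>Noetherian induction: if \<open>A\<close> is proper and not prime, some
  \<open>a * b\<close> in \<open>A\<close> has both factors outside, and every t-prime over
  \<open>A\<close> lies over one of two strictly larger radical t-ideals. The members of the set
  need not be minimal; it only has to contain a prime below each t-prime over
  \<open>A\<close>.\<close>

lemma acc_finite_minimal_primes:
  assumes acc: "acc_radical_t R" and "radical_t_ideal A"
  shows "\<exists>\<P>. finite \<P> \<and> (\<forall>P\<in>\<P>. t_prime R P \<and> A \<subseteq> P) \<and>
    (\<forall>Q. t_prime R Q \<and> A \<subseteq> Q \<longrightarrow> (\<exists>P\<in>\<P>. P \<subseteq> Q))"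
  using assms(2)
proof (induction A rule: wf_induct_rule[OF acc_radical_t_wf[OF acc]])
  case (1 A)
  note rA = \<open>radical_t_ideal A\<close>
  note AD = radical_t_idealD[OF rA]
  consider "A = R" | "t_prime R A"
    | a b where "a \<in> R" "b \<in> R" "a * b \<in> A" "a \<notin> A" "b \<notin> A"
    using AD(1) rA unfolding t_prime_def prime_ideal_def by blast
  then show ?case
  proof cases
    case 1
    have "\<not> R \<subseteq> Q" if "t_prime R Q" for Q
      using prime_not_one[OF t_primeD(1)[OF that]] R_one by blast
    then show ?thesis using 1 by (intro exI[of _ "{}"]) auto
  next
    case 2
    then show ?thesis by (intro exI[of _ "{A}"]) auto
  next
    case (3 a b)
    note ins = radical_t_ideal_insert[OF rA]
    obtain \<P> where P: "finite \<P>" "\<forall>P\<in>\<P>. t_prime R P \<and> t_radical (insert a A) \<subseteq> P"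
      "\<forall>Q. t_prime R Q \<and> t_radical (insert a A) \<subseteq> Q \<longrightarrow> (\<exists>P\<in>\<P>. P \<subseteq> Q)"
      using "1.IH"[of "t_radical (insert a A)"] ins[OF 3(1,4)] rA by auto
    obtain \<P>' where P': "finite \<P>'" "\<forall>P\<in>\<P>'. t_prime R P \<and> t_radical (insert b A) \<subseteq> P"
      "\<forall>Q. t_prime R Q \<and> t_radical (insert b A) \<subseteq> Q \<longrightarrow> (\<exists>P\<in>\<P>'. P \<subseteq> Q)"
      using "1.IH"[of "t_radical (insert b A)"] ins[OF 3(2,5)] rA by auto
    have "\<exists>P\<in>\<P> \<union> \<P>'. P \<subseteq> Q" if Q: "t_prime R Q" "A \<subseteq> Q" for Q
    proof -
      have "a \<in> Q \<or> b \<in> Q" using prime_idealD(6)[OF t_primeD(1)[OF Q(1)] 3(1,2)] 3(3) Q(2) by blast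
      then have "t_radical (insert a A) \<subseteq> Q \<or> t_radical (insert b A) \<subseteq> Q"
        using t_radical_subset_prime[OF Q(1), of "insert a A"]
          t_radical_subset_prime[OF Q(1), of "insert b A"] Q(2) by blast
      moreover have "\<exists>P\<in>\<P>. P \<subseteq> Q" if "t_radical (insert a A) \<subseteq> Q"
        using spec[OF P(3), of Q] Q(1) that by simp
      moreover have "\<exists>P\<in>\<P>'. P \<subseteq> Q" if "t_radical (insert b A) \<subseteq> Q"
        using spec[OF P'(3), of Q] Q(1) that by simp
      ultimately show ?thesis unfolding bex_Un by argo
    qed
    moreover have "\<forall>P\<in>\<P> \<union> \<P>'. t_prime R P \<and> A \<subseteq> P"
      using P(2) P'(2) ins(2)[OF 3(1,4)] ins(2)[OF 3(2,5)] by (meson UnE dual_order.trans psubset_imp_subset)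
    ultimately show ?thesis using P(1) P'(1) by (intro exI[of _ "\<P> \<union> \<P>'"]) simp
  qed
qed

section \<open>Stability of t-primes\<close>

text \<open>An element outside \<open>R_P\<close> sends some element of \<open>P\<close> to an
  element outside \<open>P\<close>.\<close>

lemma Eend_prime_subset_loc:
  assumes P: "prime_ideal R P" and M: "M \<in> t_Max R" "P \<subseteq> M"
  shows "Eend P \<subseteq> loc R P"
proof
  fix x assume x: "x \<in> Eend P"
  show "x \<in> loc R P"
  proof (rule ccontr)
    assume "x \<notin> loc R P"
    then obtain q s where "q \<in> P" "s \<in> R - P" "x * q = s"
      using not_in_loc_prime[OF P M] by blast
    then show False using x by (auto simp: Eend_def colon_def)
  qed
qed

lemma t_prime_wop:
  assumes "t_prime R P"
  shows "submod R P" "wop R P = P"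
  using prime_idealD(2)[OF t_primeD(1)[OF assms]] t_op_eq_wop[of P] t_primeD[OF assms] by auto

lemma mprod_self_nonzero:
  assumes "p \<in> P" "p \<noteq> 0"
  shows "mprod R P P \<noteq> {0}"
proof -
  have "p * p \<in> mprod R P P" "p * p \<noteq> 0" using assms by (auto intro: mprod_memI)
  then show ?thesis by blast
qed

text \<open>Stability gives \<open>p\<close> in \<open>P\<close> and \<open>c\<close> in
  \<open>(E : P)\<close> with \<open>p * c\<close> outside \<open>P R_P\<close>. But
  \<open>c\<close> maps \<open>P P\<close> into \<open>E P\<close>, which lies in
  \<open>P R_P\<close>; if \<open>P\<close> were the t-closure of \<open>P P\<close>, a multiple
  \<open>u * p\<close> with \<open>u\<close> outside \<open>M\<close> would lie in
  \<open>P P\<close>, forcing \<open>c * p\<close> into \<open>P R_P\<close>.\<close>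

lemma w_stable_prime_not_idempotent:
  assumes P: "t_prime R P" and stable: "w_stable R P"
  shows "t_op R (mprod R P P) \<noteq> P"
proof
  assume eq: "t_op R (mprod R P P) = P"
  note Pp = t_primeD(1)[OF P]
  note sP = prime_idealD(2)[OF Pp]
  obtain M where M: "M \<in> t_Max R" "P \<subseteq> M" by (rule t_prime_below_t_Max[OF P])
  \<comment> \<open>\<open>PP\<close> is the local ideal \<open>P R_P\<close>.\<close>
  define PP where "PP = {x. \<exists>t\<in>R - P. t * x \<in> P}"
  have PPloc: "submod (loc R P) PP"
    unfolding PP_def by (rule submod_saturation[OF Pp sP])
  then have PPR: "submod R PP" by (rule submod_antimono) (auto intro: R_subset_loc[OF Pp])
  have P_PP: "P \<subseteq> PP"
  proof
    fix p assume "p \<in> P"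
    then have "1 * p \<in> P" by simp
    moreover have "1 \<in> R - P" using R_one prime_not_one[OF Pp] by blast
    ultimately show "p \<in> PP" unfolding PP_def by blast
  qed
  obtain s where s: "s \<in> R - M" "s \<in> mprod R P (colon (Eend P) P)"
    using stable M(1) unfolding w_stable_iff[OF t_prime_wop[OF P]] by blast
  have "s \<notin> PP"
  proof
    assume "s \<in> PP"
    then obtain t where "t \<in> R - P" "t * s \<in> P" unfolding PP_def by blast
    then show False using prime_idealD(6)[OF Pp, of t s] s(1) M(2) by blast
  qed
  then have "\<not> mprod R P (colon (Eend P) P) \<subseteq> PP" using s by blast
  then obtain p c where pc: "p \<in> P" "c \<in> colon (Eend P) P" "p * c \<notin> PP"
    using mprod_least[OF PPR, of P "colon (Eend P) P"] by blast
  have "p \<noteq> 0" using pc(3) submod_zero[OF PPR] by auto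
  then have "p \<in> wop R (mprod R P P)"
    using eq pc(1) t_op_eq_wop[OF submod_mprod mprod_self_nonzero] by blast
  then obtain u where u: "u \<in> R - M" "u * p \<in> mprod R P P"
    using M(1) unfolding mem_wop[OF submod_mprod] by blast
  have "mprod R P P \<subseteq> {x. c * x \<in> PP}"
  proof (rule mprod_least[OF submod_scaled[OF PPR]])
    fix a b assume ab: "a \<in> P" "b \<in> P"
    have "c * a \<in> loc R P"
      using pc(2) ab Eend_prime_subset_loc[OF Pp M] by (auto simp: colon_def)
    then have "(c * a) * b \<in> PP" using submod_mult[OF PPloc] P_PP ab by blast
    then show "a * b \<in> {x. c * x \<in> PP}" by (simp add: mult.assoc)
  qed
  then have "c * (u * p) \<in> PP" using u by blast
  moreover have "inverse u \<in> loc R P" using inverse_in_loc[OF Pp] u M by blast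
  ultimately have "inverse u * (c * (u * p)) \<in> PP" using submod_mult[OF PPloc] by blast
  moreover have "u \<noteq> 0" using u prime_idealD(5)[OF Pp] M by blast
  then have "inverse u * (c * (u * p)) = p * c" by (simp add: field_simps)
  ultimately show False using pc by simp
qed

text \<open>Finitely many elements of \<open>P (E : P)\<close> with 1 in their v-closure use only a
  finite \<open>J\<close> on the left. Suppose a t-prime \<open>Q\<close> over \<open>J\<close>
  omits \<open>p\<close> in \<open>P\<close>. For \<open>N\<close> over \<open>Q\<close> and such an
  element \<open>s\<close> outside \<open>N\<close>, the product \<open>p * s\<close> lies in
  \<open>J E\<close>. Since \<open>E\<close> lies in \<open>R_W\<close> for some prime
  \<open>W\<close> over \<open>Q\<close>, this puts \<open>p * s\<close> into \<open>Q\<close>,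
  although neither factor is there.\<close>

lemma w_stable_prime_finite:
  assumes P: "t_prime R P" and stable: "w_stable R P"
  shows "\<exists>J. finite J \<and> J \<subseteq> P \<and> P \<subseteq> t_radical J"
proof -
  note Pp = t_primeD(1)[OF P]
  note sP = prime_idealD(2)[OF Pp]
  let ?C = "colon (Eend P) P"
  \<comment> \<open>The trace of \<open>P (E : P)\<close> on \<open>R\<close>, written with
    \<open>r * 1\<close> to match \<open>conductor_ideal\<close>.\<close>
  let ?A = "{r\<in>R. r * 1 \<in> mprod R P ?C}"
  have nsub: "\<not> ?A \<subseteq> M" if "M \<in> t_Max R" for M
    using stable that unfolding w_stable_iff[OF t_prime_wop[OF P]] by auto
  obtain M where M: "M \<in> t_Max R" using t_Max_nonempty by blast
  have A0: "?A \<noteq> {0}"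
  proof
    assume eq: "?A = {0}"
    show False using nsub[OF M] submod_zero[OF t_MaxD(2)[OF M]] unfolding eq by simp
  qed
  obtain S where S: "finite S" "S \<subseteq> ?A" "\<exists>s\<in>S. s \<noteq> 0" "1 \<in> vop R S"
    by (rule t_Max_cover[OF conductor_ideal[OF submod_mprod] A0 nsub])
  then obtain J where J: "finite J" "J \<subseteq> P" "S \<subseteq> mprod R J ?C"
    using mprod_finite_left_set[of S R P ?C] by auto
  have "p \<in> Q" if p: "p \<in> P" and Q: "t_prime R Q" "J \<subseteq> Q" for p Q
  proof (rule ccontr)
    assume pQ: "p \<notin> Q"
    note Qp = t_primeD(1)[OF Q(1)]
    obtain N where N: "N \<in> t_Max R" "Q \<subseteq> N" by (rule t_prime_below_t_Max[OF Q(1)])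
    obtain s where s: "s \<in> S" "s \<notin> N" using t_Max_vop_one[OF N(1) S(1,3,4)] by blast
    have sR: "s \<in> R" using s S by blast
    have ps: "p * s \<in> mprod R J (Eend P)"
      by (rule mprod_mult_right[of s R J ?C]) (use s J p in \<open>auto simp: colon_def mult.commute\<close>)
    \<comment> \<open>If \<open>P\<close> lies in \<open>N\<close>, comparability gives
      \<open>Q \<subseteq> P\<close> and \<open>W = P\<close> works. Otherwise an element of
      \<open>P\<close> outside \<open>N\<close> is a common denominator for \<open>E\<close> at
      \<open>N\<close>, and \<open>W = N\<close> works.\<close>
    obtain W where W: "prime_ideal R W" "Q \<subseteq> W" "Eend P \<subseteq> loc R W"
    proof (cases "P \<subseteq> N")
      case True
      then have "Q \<subseteq> P" using primes_comparable[OF Pp Qp N(1) _ N(2)] p pQ by blast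
      then show ?thesis using that[OF Pp] Eend_prime_subset_loc[OF Pp N(1) True] by blast
    next
      case False
      then obtain q where q: "q \<in> P" "q \<notin> N" by blast
      note Np = t_Max_prime[OF N(1)]
      have "e \<in> loc R N" if "e \<in> Eend P" for e
      proof -
        have "q * e \<in> R" using that q prime_idealD(3)[OF Pp] by (auto simp: Eend_def colon_def mult.commute)
        moreover have "q \<in> R - N" using q prime_idealD(3)[OF Pp] by blast
        ultimately show ?thesis using mem_loc_prime[OF Np] by blast
      qed
      then show ?thesis using that[OF Np N(2)] by blast
    qed
    \<comment> \<open>This is \<open>Q R_W\<close>; its elements in \<open>R\<close> lie in
      \<open>Q\<close> because \<open>Q \<subseteq> W\<close>.\<close>
    let ?X = "{x. \<exists>t\<in>R - W. t * x \<in> Q}"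
    have X: "submod (loc R W) ?X"
      by (rule submod_saturation[OF W(1) prime_idealD(2)[OF Qp]])
    have "submod R ?X"
      by (rule submod_antimono[OF X]) (auto intro: R_subset_loc[OF W(1)])
    then have "mprod R J (Eend P) \<subseteq> ?X"
    proof (rule mprod_least)
      fix j e assume je: "j \<in> J" "e \<in> Eend P"
      have "1 * j \<in> Q" using je Q by auto
      moreover have "1 \<in> R - W" using R_one prime_not_one[OF W(1)] by blast
      ultimately have "j \<in> ?X" by blast
      then have "e * j \<in> ?X" using submod_mult[OF X, of e j] je W(3) by blast
      then show "j * e \<in> ?X" by (simp add: mult.commute)
    qed
    then obtain t where t: "t \<in> R - W" "t * (p * s) \<in> Q" using ps by blast
    have pR: "p \<in> R" using p prime_idealD(3)[OF Pp] by blast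
    have "p * s \<in> Q" using prime_idealD(6)[OF Qp, of t "p * s"] t W(2) R_mult[OF pR sR] by blast
    then show False using prime_idealD(6)[OF Qp pR sR] pQ s N(2) by blast
  qed
  then have "P \<subseteq> t_radical J" using prime_idealD(3)[OF Pp] by (auto intro: t_radicalI)
  then show ?thesis using J by blast
qed

section \<open>Divisoriality of radical t-ideals\<close>

text \<open>Any \<open>x\<close> in \<open>P\<close> outside the t-closure of \<open>P P\<close>
  generates \<open>P R_P\<close>: otherwise \<open>x = y * (q / s)\<close> with \<open>y\<close>,
  \<open>q\<close> in \<open>P\<close> and \<open>s\<close> outside \<open>P\<close>, and up to a
  factor outside some t-maximal \<open>M\<close> this displays \<open>x\<close> as an element of
  \<open>P P\<close>.\<close>

lemma t_prime_local_generator: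
  assumes P: "t_prime R P" and disc: "t_op R (mprod R P P) \<noteq> P"
  obtains x where "x \<in> P" "x \<noteq> 0" "\<And>y. y \<in> P \<Longrightarrow> y / x \<in> loc R P"
proof -
  note Pp = t_primeD(1)[OF P]
  note sP = prime_idealD(2)[OF Pp]
  obtain p where p: "p \<in> P" "p \<noteq> 0" using prime_nonzero_elt[OF Pp t_primeD(3)[OF P]] by blast
  have "mprod R P P \<subseteq> P"
    by (rule mprod_least[OF sP]) (use submod_mult[OF sP] prime_idealD(3)[OF Pp] in blast)
  then have "t_op R (mprod R P P) \<subseteq> P" using t_op_mono t_primeD(2)[OF P] by blast
  then obtain x where x: "x \<in> P" "x \<notin> t_op R (mprod R P P)" using disc by blast
  then have "x \<notin> wop R (mprod R P P)"
    using t_op_eq_wop[OF submod_mprod mprod_self_nonzero[OF p]] by simp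
  then obtain M where M: "M \<in> t_Max R" and n: "\<And>s. s \<in> R - M \<Longrightarrow> s * x \<notin> mprod R P P"
    unfolding mem_wop[OF submod_mprod] by blast
  have PM: "P \<subseteq> M"
  proof
    fix q assume q: "q \<in> P"
    then show "q \<in> M" using n[of q] mprod_memI[of q P x P R] x prime_idealD(3)[OF Pp] by blast
  qed
  have x0: "x \<noteq> 0"
  proof
    assume "x = 0"
    then have "1 * x \<in> mprod R P P" using submod_zero[OF submod_mprod] by simp
    then show False using n[of 1] prime_not_one[OF t_Max_prime[OF M]] R_one by blast
  qed
  have "y / x \<in> loc R P" if y: "y \<in> P" for y
  proof (rule ccontr)
    assume "y / x \<notin> loc R P"
    then obtain q s where q: "q \<in> P" "s \<in> R - P" "y / x * q = s"
      using not_in_loc_prime[OF Pp M PM] by blast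
    have s0: "s \<noteq> 0" using q prime_idealD(5)[OF Pp] by blast
    have xs: "s * x = y * q" using q(3) x0 by (auto simp: field_simps)
    have "inverse s * q \<in> loc R M"
      by (rule mult_prime_in_loc[OF Pp M PM inverse_in_loc[OF Pp q(2)] q(1)])
    then obtain t where t: "t \<in> R - M" "t * (inverse s * q) \<in> R"
      using mem_loc_prime[OF t_Max_prime[OF M]] by blast
    \<comment> \<open>From \<open>s * r = t * q\<close> in \<open>P\<close> and \<open>s\<close>
      outside \<open>P\<close>, primality gives \<open>r\<close> in \<open>P\<close>; then
      \<open>y * r = t * x\<close> puts \<open>t * x\<close> into \<open>P P\<close> with
      \<open>t\<close> outside \<open>M\<close>.\<close>
    define r where "r = t * (inverse s * q)"
    have rs: "s * r = t * q" using s0 by (simp add: r_def)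
    have "t * q \<in> P" using submod_mult[OF sP] t q by blast
    then have "r \<in> P" using prime_idealD(6)[OF Pp, of s r] rs t q unfolding r_def[symmetric] by auto
    then have "y * r \<in> mprod R P P" using y by (intro mprod_memI)
    moreover have "s * (y * r) = y * (s * r)" by (simp add: ac_simps)
    then have "s * (y * r) = t * (y * q)" unfolding rs by (simp add: ac_simps)
    then have "s * (y * r) = s * (t * x)" unfolding xs[symmetric] by (simp add: ac_simps)
    then have "y * r = t * x" using s0 by simp
    ultimately show False using n t by auto
  qed
  then show ?thesis using that x x0 by blast
qed

text \<open>A finite \<open>J\<close> in \<open>P\<close> is formed from a generator of
  \<open>P R_P\<close> and generators of \<open>P\<close> up to t-radical. For \<open>c\<close> in
  \<open>(R : J)\<close> the first controls \<open>c P\<close> at \<open>P\<close>, the second at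
  the t-maximal ideals not containing \<open>P\<close>. If \<open>P\<close> is t-maximal, these
  cover all cases and \<open>(R : J) = (R : P)\<close>. Otherwise only
  \<open>c P P \<subseteq> R\<close> follows, and an element of \<open>M - P\<close> closes the
  gap.\<close>

lemma t_prime_divisorial:
  assumes P: "t_prime R P" and disc: "t_op R (mprod R P P) \<noteq> P" and acc: "acc_radical_t R"
  shows "vop R P = P"
proof
  show "P \<subseteq> vop R P" by (rule vop_superset)
  note Pp = t_primeD(1)[OF P]
  note sP = prime_idealD(2)[OF Pp]
  note PR = prime_idealD(3)[OF Pp]
  obtain x where x: "x \<in> P" "x \<noteq> 0" "\<And>y. y \<in> P \<Longrightarrow> y / x \<in> loc R P"
    by (rule t_prime_local_generator[OF P disc]) blast
  obtain F where F: "finite F" "F \<subseteq> P" "P \<subseteq> t_radical F"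
    by (rule acc_finite_t_radical[OF acc PR x(1,2)])
  define J where "J = insert x F"
  have J: "finite J" "J \<subseteq> P" "x \<in> J" using F x by (auto simp: J_def)
  have J0: "\<exists>j\<in>J. j \<noteq> 0" using J x by blast
  have vJ: "vop R J \<subseteq> P"
  proof
    fix y assume "y \<in> vop R J"
    then have "y \<in> t_op R P" unfolding mem_t_op[OF sP] using J J0 by blast
    then show "y \<in> P" using t_primeD(2)[OF P] by simp
  qed
  have away: "c * p \<in> loc R N"
    if N: "N \<in> t_Max R" "\<not> P \<subseteq> N" and c: "c \<in> colon R J" and p: "p \<in> P" for c p N
  proof -
    note Np = t_Max_prime[OF N(1)]
    have "\<not> F \<subseteq> N" using t_radical_subset_prime[OF t_Max_t_prime[OF N(1)], of F] F(3) N(2) by blast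
    then obtain j where j: "j \<in> J" "j \<notin> N" by (auto simp: J_def)
    then have "j \<in> R - N" "j * c \<in> R" using J PR c by (auto simp: colon_def mult.commute)
    then have "c \<in> loc R N" using mem_loc_prime[OF Np] by blast
    then show ?thesis using loc_mult[OF Np] R_subset_loc[OF Np] p PR by blast
  qed
  have at: "c * p \<in> loc R P" if c: "c \<in> colon R J" and p: "p \<in> P" for c p
  proof -
    have "c * x \<in> loc R P" using c J by (intro R_subset_loc[OF Pp]) (simp add: colon_def)
    then have "(c * x) * (p / x) \<in> loc R P" using x(3)[OF p] by (rule loc_mult[OF Pp])
    then show ?thesis using x(2) by simp
  qed
  show "vop R P \<subseteq> P"
  proof (cases "P \<in> t_Max R")
    case True
    have "colon R J \<subseteq> colon R P"
    proof
      fix c assume c: "c \<in> colon R J"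
      have "c * p \<in> R" if p: "p \<in> P" for p
      proof (rule Inter_loc)
        fix N assume N: "N \<in> t_Max R"
        show "c * p \<in> loc R N"
        proof (cases "P \<subseteq> N")
          case True
          then have "N = P" by (rule t_Max_maximal[OF \<open>P \<in> t_Max R\<close> N])
          then show ?thesis using at[OF c p] by simp
        qed (rule away[OF N _ c p])
      qed
      then show "c \<in> colon R P" by (simp add: colon_def)
    qed
    then have "vop R P \<subseteq> vop R J" by (auto simp: vop_def colon_def)
    then show ?thesis using vJ by blast
  next
    case False
    obtain M where M: "M \<in> t_Max R" "P \<subseteq> M" by (rule t_prime_below_t_Max[OF P])
    note Mp = t_Max_prime[OF M(1)]
    show ?thesis
    proof
      fix y assume y: "y \<in> vop R P"
      have "1 \<in> colon R P" using PR by (auto simp: colon_def)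
      then have yR: "y \<in> R" using vop_colon[OF y] by fastforce
      \<comment> \<open>Above \<open>P\<close>, \<open>mult_prime_in_loc\<close> makes a second
        factor from \<open>P\<close> move \<open>c * p\<close> from \<open>R_P\<close> into
        \<open>R_N\<close>. So \<open>c * p\<close> is in \<open>(R : P)\<close> and can be tested
        against \<open>y\<close>.\<close>
      have yP: "y * p \<in> vop R J" if p: "p \<in> P" for p
      proof -
        have "y * p * c \<in> R" if c: "c \<in> colon R J" for c
        proof -
          have "c * p \<in> colon R P"
            unfolding colon_def
          proof (intro CollectI ballI)
            fix p' assume p': "p' \<in> P"
            show "c * p * p' \<in> R"
            proof (rule Inter_loc)
              fix N assume N: "N \<in> t_Max R"
              show "c * p * p' \<in> loc R N"
              proof (cases "P \<subseteq> N")
                case True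
                show ?thesis by (rule mult_prime_in_loc[OF Pp N True at[OF c p] p'])
              next
                case False
                note Np = t_Max_prime[OF N]
                show ?thesis
                  using loc_mult[OF Np away[OF N False c p]] R_subset_loc[OF Np] p' PR by blast
              qed
            qed
          qed
          then have "y * (c * p) \<in> R" by (rule vop_colon[OF y])
          then show ?thesis by (simp add: ac_simps)
        qed
        then show ?thesis by (simp add: vop_def colon_def)
      qed
      show "y \<in> P"
      proof (rule ccontr)
        assume yn: "y \<notin> P"
        have y0: "y \<noteq> 0" using yn prime_idealD(5)[OF Pp] by blast
        \<comment> \<open>With \<open>y\<close> and \<open>m\<close> outside \<open>P\<close>, the
          product \<open>y * m\<close> divides all of \<open>P\<close> in \<open>R_M\<close>, in
          particular the local generator \<open>a\<close> of \<open>J\<close>. Writing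
          \<open>s * a = y * m * p\<close> and multiplying \<open>y * p * (u / a)\<close>, which is
          in \<open>R\<close>, by \<open>m\<close> yields \<open>s * u\<close> in \<open>M\<close>,
          a contradiction.\<close>
        have "P \<noteq> M" using False M by blast
        then obtain m where m: "m \<in> M" "m \<notin> P" using M by blast
        have mR: "m \<in> R" using m t_MaxD(3)[OF M(1)] by blast
        have m0: "m \<noteq> 0" using m prime_idealD(5)[OF Pp] by blast
        obtain a u where a: "a \<in> J" "a \<noteq> 0" "u \<in> R - M" "u / a \<in> colon R J"
          by (rule finite_local_generator[OF J(1) J0 M(1)])
        have ym: "y * m \<in> R - P" using prime_idealD(6)[OF Pp yR mR] yn m R_mult[OF yR mR] by blast
        have "inverse (y * m) * a \<in> loc R M"
          using mult_prime_in_loc[OF Pp M inverse_in_loc[OF Pp ym]] a J by blast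
        then obtain s where s: "s \<in> R - M" "s * (inverse (y * m) * a) \<in> R"
          using mem_loc_prime[OF Mp] by blast
        define p where "p = s * (inverse (y * m) * a)"
        have yp: "(y * m) * p = s * a" using y0 m0 by (simp add: p_def field_simps)
        have "s * a \<in> P" using submod_mult[OF sP] s a J by blast
        then have "p \<in> P" using prime_idealD(6)[OF Pp, of "y * m" p] ym yp s(2) unfolding p_def[symmetric] by auto
        then have "y * p * (u / a) \<in> R" using vop_colon[OF yP a(4)] by blast
        then have "(y * p * (u / a)) * m \<in> M" using submod_mult[OF t_MaxD(2)[OF M(1)]] m by blast
        moreover have "(y * p * (u / a)) * m = ((y * m) * p) * (u / a)" by (simp add: ac_simps)
        then have "(y * p * (u / a)) * m = s * u" unfolding yp using a(2) by simp
        ultimately show False using prime_idealD(6)[OF Mp, of s u] s a by auto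
      qed
    qed
  qed
qed

lemma vop_R: "vop R R = R"
proof
  have "1 \<in> colon R R" by (simp add: colon_def)
  then show "vop R R \<subseteq> R" using vop_colon[of _ R R 1] by auto
qed (rule vop_superset)

lemma radical_t_ideal_divisorial:
  assumes disc: "strongly_discrete R" and acc: "acc_radical_t R" and I: "radical_t_ideal I"
  shows "divisorial R I"
proof -
  \<comment> \<open>Including \<open>R\<close> makes this intersection equal to
    \<open>t_radical I\<close> even when no t-prime contains \<open>I\<close>.\<close>
  define \<I> where "\<I> = insert R {Q. t_prime R Q \<and> I \<subseteq> Q}"
  have "\<Inter>\<I> = t_radical I" unfolding \<I>_def t_radical_def by auto
  then have eq: "\<Inter>\<I> = I" using radical_t_idealD(5)[OF I] by simp
  have "vop R Q = Q" if "Q \<in> \<I>" for Q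
    using that vop_R t_prime_divisorial[OF _ _ acc, of Q] disc
    unfolding \<I>_def strongly_discrete_def by blast
  then have "vop R (\<Inter>\<I>) = \<Inter>\<I>" by (rule Inter_divisorial)
  then show ?thesis using I unfolding eq divisorial_def t_ideal_def by simp
qed

section \<open>Stability of divisorial ideals\<close>

lemma inverse_in_loc_prime:
  assumes P: "prime_ideal R P" and M: "M \<in> t_Max R" "P \<subseteq> M" and x: "x \<notin> loc R P"
  shows "inverse x \<in> loc R P"
proof -
  obtain q s where q: "q \<in> P" "q \<noteq> 0" "s \<in> R - P" "x * q = s" by (rule not_in_loc_prime[OF P M x])
  have "inverse s * q \<in> loc R P"
    using inverse_in_loc[OF P q(3)] R_subset_loc[OF P] prime_idealD(3)[OF P] q(1) loc_mult[OF P] by blast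
  moreover have "inverse s * q = inverse x" unfolding q(4)[symmetric] using q(2) by simp
  ultimately show ?thesis by simp
qed

text \<open>The local ideal \<open>W = I R\<^sub>P\<close> is principal over \<open>(W : W) = R\<^sub>Q\<close>: any \<open>a \<in> I\<close> outside
  \<open>q W\<close> generates it, where \<open>q\<close> generates \<open>Q R\<^sub>Q\<close>.\<close>

lemma ideal_local_generator:
  assumes disc: "strongly_discrete R" and P: "t_prime R P" and I: "ideal R I" "I \<noteq> {0}"
  obtains Q a where "t_prime R Q" "Q \<subseteq> P" "a \<in> I" "a \<noteq> 0" "\<forall>i\<in>I. i / a \<in> loc R Q"
    "\<forall>i\<in>I. \<forall>y\<in>loc R Q. \<exists>s\<in>R - P. s * (y * i) \<in> I"
proof -
  note Pp = t_primeD(1)[OF P]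
  have sI: "submod R I" and IR: "I \<subseteq> R" using I by (auto simp: ideal_def)
  obtain i0 where i0: "i0 \<in> I" "i0 \<noteq> 0" using submod_nonzero[OF sI] I(2) by blast
  obtain M where M: "M \<in> t_Max R" "P \<subseteq> M" by (rule t_prime_below_t_Max[OF P])
  \<comment> \<open>\<open>W\<close> is \<open>I R_P\<close> and \<open>E\<close>, defined below, is
    its endomorphism ring, a valuation ring containing \<open>R_P\<close>.\<close>
  define W where "W = {x. \<exists>s\<in>R - P. s * x \<in> I}"
  have W: "submod (loc R P) W" unfolding W_def by (rule submod_saturation[OF Pp sI])
  have IW: "I \<subseteq> W"
  proof
    fix i assume "i \<in> I"
    then have "1 * i \<in> I" by simp
    moreover have "1 \<in> R - P" using R_one prime_not_one[OF Pp] by blast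
    ultimately show "i \<in> W" unfolding W_def by blast
  qed
  define E where "E = colon W W"
  have ED: "e * w \<in> W" if "e \<in> E" "w \<in> W" for e w using that by (simp add: E_def colon_def)
  have EI: "e \<in> E" if "\<And>w. w \<in> W \<Longrightarrow> e * w \<in> W" for e using that by (simp add: E_def colon_def)
  have locE: "e \<in> E" if "e \<in> loc R P" for e using that submod_mult[OF W] by (intro EI)
  have RE: "r \<in> E" if "r \<in> R" for r using that by (intro locE R_subset_loc[OF Pp])
  have Emult: "e * e' \<in> E" if "e \<in> E" "e' \<in> E" for e e'
    using that ED by (intro EI) (simp add: mult.assoc)
  have Eadd: "e + e' \<in> E" if "e \<in> E" "e' \<in> E" for e e'
    using that ED by (intro EI) (simp add: distrib_right submod_add[OF W])
  have Eval: "x \<in> E \<or> inverse x \<in> E" for x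
    using inverse_in_loc_prime[OF Pp M, of x] locE by blast
  \<comment> \<open>The contraction to \<open>R\<close> of the maximal ideal of \<open>E\<close>:
    the elements that are not units in \<open>E\<close>. It is closed under addition because one of
    \<open>a / b\<close> and \<open>b / a\<close> lies in \<open>E\<close>.\<close>
  define Q where "Q = {r\<in>R. r = 0 \<or> inverse r \<notin> E}"
  have Qadd1: False if ab: "a \<noteq> 0" "b \<noteq> 0" "inverse b \<notin> E" "a + b \<noteq> 0" "inverse (a + b) \<in> E" "a / b \<in> E" for a b
  proof -
    have "(a / b + 1) * inverse (a + b) \<in> E" using ab RE[OF R_one] by (intro Emult Eadd)
    moreover have "(a / b + 1) * inverse (a + b) = inverse b" using ab by (simp add: field_simps)
    ultimately show False using ab by simp
  qed
  have "submod R Q"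
    unfolding submod_def
  proof (intro conjI ballI)
    show "0 \<in> Q" using R_zero by (simp add: Q_def)
  next
    fix a b assume ab: "a \<in> Q" "b \<in> Q"
    have "a + b = 0 \<or> inverse (a + b) \<notin> E"
    proof (rule ccontr)
      assume n: "\<not> ?thesis"
      then have nz: "a \<noteq> 0" "b \<noteq> 0" using ab by (auto simp: Q_def)
      have "a / b \<in> E \<or> b / a \<in> E" using Eval[of "a / b"] by (simp add: inverse_eq_divide)
      then show False
      proof
        assume "a / b \<in> E"
        then show False using Qadd1[of a b] ab n nz by (auto simp: Q_def)
      next
        assume "b / a \<in> E"
        then show False using Qadd1[of b a] ab n nz by (auto simp: Q_def add.commute)
      qed
    qed
    then show "a + b \<in> Q" using ab by (auto simp: Q_def R_add)
  next
    fix r a assume ra: "r \<in> R" "a \<in> Q"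
    have "r * a = 0 \<or> inverse (r * a) \<notin> E"
    proof (rule ccontr)
      assume n: "\<not> ?thesis"
      then have "r * inverse (r * a) \<in> E" using RE[OF ra(1)] by (intro Emult) auto
      moreover have "r * inverse (r * a) = inverse a" using n by simp
      ultimately have "inverse a \<in> E" by (simp only:)
      then show False using ra n by (auto simp: Q_def)
    qed
    then show "r * a \<in> Q" using ra by (auto simp: Q_def R_mult)
  qed
  moreover have "Q \<subseteq> R" by (auto simp: Q_def)
  moreover have "1 \<notin> Q" using RE[OF R_one] by (simp add: Q_def)
  moreover have "a \<in> Q \<or> b \<in> Q" if ab: "a \<in> R" "b \<in> R" "a * b \<in> Q" for a b
  proof (rule ccontr)
    assume "\<not> ?thesis"
    then have n: "a \<noteq> 0" "b \<noteq> 0" "inverse a \<in> E" "inverse b \<in> E" using ab by (auto simp: Q_def)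
    then have "inverse a * inverse b \<in> E" by (intro Emult)
    then show False using n ab by (simp add: Q_def)
  qed
  ultimately have Qp: "prime_ideal R Q" unfolding prime_ideal_def ideal_def using R_one by blast
  have QP: "Q \<subseteq> P"
  proof
    fix r assume r: "r \<in> Q"
    show "r \<in> P"
    proof (rule ccontr)
      assume "r \<notin> P"
      then have "r \<noteq> 0" "inverse r \<in> E"
        using r prime_idealD(5)[OF Pp] locE inverse_in_loc[OF Pp, of r] by (auto simp: Q_def)
      then show False using r by (simp add: Q_def)
    qed
  qed
  \<comment> \<open>If \<open>Q\<close> were zero, \<open>i0 * p\<close> would be a unit of
    \<open>E\<close>, so \<open>1/p\<close> would lie in \<open>W \<subseteq> R_P\<close> although
    \<open>p\<close> is in \<open>P\<close>.\<close>
  have Q0: "Q \<noteq> {0}"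
  proof
    assume "Q = {0}"
    obtain p where p: "p \<in> P" "p \<noteq> 0" using prime_nonzero_elt[OF Pp t_primeD(3)[OF P]] by blast
    have pR: "p \<in> R" using p prime_idealD(3)[OF Pp] by blast
    have "i0 * p \<in> R" using pR i0 IR R_mult by blast
    moreover have "i0 * p \<notin> Q" using \<open>Q = {0}\<close> p i0 by simp
    ultimately have "inverse (i0 * p) \<in> E" by (simp add: Q_def)
    then have "inverse (i0 * p) * i0 \<in> W" using ED IW i0 by blast
    moreover have "inverse (i0 * p) * i0 = inverse p" using i0 p by (simp add: field_simps)
    ultimately have "inverse p \<in> W" by (simp only:)
    then obtain s where s: "s \<in> R - P" "s * inverse p \<in> I" unfolding W_def by blast
    have "(s * inverse p) * p \<in> P" using submod_mult[OF prime_idealD(2)[OF Pp]] s IR p by blast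
    then show False using s p by (simp add: mult.assoc)
  qed
  have QM: "Q \<subseteq> M" using QP M(2) by blast
  have Qt: "t_prime R Q" by (rule t_primeI[OF Qp Q0 M(1) QM])
  have locQE: "y \<in> E" if y: "y \<in> loc R Q" for y
  proof -
    obtain s where s: "s \<in> R - Q" "s * y \<in> R" using y mem_loc_prime[OF Qp] by blast
    then have "s \<noteq> 0" "inverse s \<in> E" by (auto simp: Q_def)
    then have "inverse s * (s * y) \<in> E" using Emult[OF _ RE[OF s(2)]] by blast
    then show ?thesis using \<open>s \<noteq> 0\<close> by (simp add: mult.assoc[symmetric])
  qed
  have "t_op R (mprod R Q Q) \<noteq> Q" using disc Qt by (simp add: strongly_discrete_def)
  then obtain q where q: "q \<in> Q" "q \<noteq> 0" "\<And>y. y \<in> Q \<Longrightarrow> y / q \<in> loc R Q"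
    by (rule t_prime_local_generator[OF Qt]) blast
  \<comment> \<open>Otherwise \<open>1/q\<close> maps \<open>W\<close> into itself, making
    \<open>q\<close> a unit of \<open>E\<close>.\<close>
  have "\<exists>a\<in>I. inverse q * a \<notin> W"
  proof (rule ccontr)
    assume n: "\<not> ?thesis"
    have "inverse q \<in> E"
    proof (rule EI)
      fix w assume "w \<in> W"
      then obtain s where s: "s \<in> R - P" "s * w \<in> I" unfolding W_def by blast
      then have "inverse q * (s * w) \<in> W" using n by blast
      then have "inverse s * (inverse q * (s * w)) \<in> W"
        using submod_mult[OF W inverse_in_loc[OF Pp s(1)]] by blast
      moreover have "s \<noteq> 0" using s prime_idealD(5)[OF Pp] by blast
      then have "inverse s * (inverse q * (s * w)) = inverse q * w" by simp
      ultimately show "inverse q * w \<in> W" by (simp only:)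
    qed
    then show False using q by (simp add: Q_def)
  qed
  then obtain a where a: "a \<in> I" "inverse q * a \<notin> W" by blast
  have a0: "a \<noteq> 0" using a submod_zero[OF W] by auto
  \<comment> \<open>If not, \<open>a = i * z / s\<close> with \<open>z\<close> in \<open>Q\<close>.
    As \<open>z / q\<close> and \<open>1/s\<close> lie in \<open>R_Q\<close>, hence in
    \<open>E\<close>, the element \<open>a / q\<close> would be in \<open>W\<close>.\<close>
  have "i / a \<in> loc R Q" if i: "i \<in> I" for i
  proof (rule ccontr)
    assume "i / a \<notin> loc R Q"
    then obtain z s where z: "z \<in> Q" "s \<in> R - Q" "i / a * z = s"
      using not_in_loc_prime[OF Qp M(1) QM] by blast
    have s0: "s \<noteq> 0" using z prime_idealD(5)[OF Qp] by blast
    have "(inverse s * (z / q)) \<in> E"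
      using inverse_in_loc[OF Qp z(2)] q(3)[OF z(1)] by (intro Emult locQE)
    then have "(inverse s * (z / q)) * i \<in> W" using ED IW i by blast
    moreover have "i * z = s * a" using z(3) a0 by (auto simp: field_simps)
    then have "(inverse s * (z / q)) * i = inverse q * a" using s0 q(2) by (simp add: field_simps)
    ultimately have "inverse q * a \<in> W" by (simp only:)
    then show False using a by blast
  qed
  moreover have "\<exists>s\<in>R - P. s * (y * i) \<in> I" if "i \<in> I" "y \<in> loc R Q" for i y
    using ED[OF locQE[OF that(2)]] IW that(1) unfolding W_def by blast
  ultimately show ?thesis using that[OF Qt QP a(1) a0] by blast
qed

text \<open>The aim is a finite \<open>J\<close> in \<open>I\<close> with
  \<open>(R : J) \<subseteq> (E : I)\<close>: then \<open>J (R : J)\<close> lies in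
  \<open>I (E : I)\<close>, and \<open>finite_local_generator\<close> keeps it out of every
  t-maximal ideal.\<close>

lemma divisorial_w_stable:
  assumes disc: "strongly_discrete R" and acc: "acc_radical_t R"
    and I: "ideal R I" "divisorial R I"
  shows "w_stable R I"
proof -
  have sI: "submod R I" and IR: "I \<subseteq> R" using I by (auto simp: ideal_def)
  have I0: "I \<noteq> {0}" and vI: "vop R I = I" using I(2) by (auto simp: divisorial_def frac_ideal_def)
  obtain i0 where i0: "i0 \<in> I" "i0 \<noteq> 0" using submod_nonzero[OF sI] I0 by blast
  have vopI: "x \<in> I" if "\<And>b. b \<in> colon R I \<Longrightarrow> x * b \<in> R" for x
  proof -
    have "x \<in> vop R I" using that by (simp add: vop_def colon_def)
    then show ?thesis using vI by simp
  qed
  have "wop R I \<subseteq> I"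
  proof
    fix x assume x: "x \<in> wop R I"
    show "x \<in> I"
    proof (rule vopI)
      fix b assume b: "b \<in> colon R I"
      show "x * b \<in> R"
      proof (rule Inter_loc)
        fix M assume M: "M \<in> t_Max R"
        then obtain s where s: "s \<in> R - M" "s * x \<in> I" using x unfolding mem_wop[OF sI] by blast
        then have "b * (s * x) \<in> R" using b by (simp add: colon_def)
        then have "s * (x * b) \<in> R" by (simp add: ac_simps)
        then show "x * b \<in> loc R M" using s mem_loc_prime[OF t_Max_prime[OF M]] by blast
      qed
    qed
  qed
  then have wI: "wop R I = I" using wop_superset by blast
  define C where "C = colon (Eend I) I"
  \<comment> \<open>Divisoriality of \<open>I\<close> gives \<open>E = (R : I (R : I))\<close>, so
    membership in \<open>E\<close> is tested by products landing in \<open>R\<close>, hence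
    locally.\<close>
  have EendI: "e \<in> Eend I" if e: "\<And>i b. i \<in> I \<Longrightarrow> b \<in> colon R I \<Longrightarrow> e * i * b \<in> R" for e
    unfolding Eend_def colon_def using vopI e by blast
  have EendD: "e * i \<in> I" if "e \<in> Eend I" "i \<in> I" for e i
    using that by (simp add: Eend_def colon_def)
  have RE: "r \<in> Eend I" if "r \<in> R" for r
    using that submod_mult[OF sI] by (simp add: Eend_def colon_def)
  have BC: "b \<in> C" if "b \<in> colon R I" for b
    using that RE by (auto simp: C_def colon_def)
  define D where "D = {r\<in>R. r * 1 \<in> mprod R I C}"
  have idD: "ideal R D" unfolding D_def by (rule conductor_ideal[OF submod_mprod])
  have DR: "D \<subseteq> R" using idD by (simp add: ideal_def)
  have BI: "k * b \<in> D" if "k \<in> I" "b \<in> colon R I" for k b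
  proof -
    have "b * k \<in> R" using that by (simp add: colon_def)
    then have "k * b \<in> R" by (simp add: mult.commute)
    moreover have "k * b \<in> mprod R I C" using that BC by (intro mprod_memI) auto
    ultimately show ?thesis by (simp add: D_def)
  qed
  have "1 \<in> colon R I" using IR by (auto simp: colon_def)
  then have i0D: "i0 \<in> D" using BI[OF i0(1)] by fastforce
  obtain F where F: "finite F" "F \<subseteq> D" "D \<subseteq> t_radical F"
    by (rule acc_finite_t_radical[OF acc DR i0D i0(2)])
  have "F \<subseteq> mprod R I C" using F(2) by (auto simp: D_def)
  then obtain J1 where J1: "finite J1" "J1 \<subseteq> I" "F \<subseteq> mprod R J1 C"
    using mprod_finite_left_set[OF F(1), of R I C] by blast
  have rD: "radical_t_ideal (t_radical D)"
    by (rule t_radical_radical_t_ideal[OF DR]) (use i0 i0D in blast)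
  obtain \<P> where P: "finite \<P>" "\<forall>P\<in>\<P>. t_prime R P \<and> t_radical D \<subseteq> P"
    "\<forall>Q. t_prime R Q \<and> t_radical D \<subseteq> Q \<longrightarrow> (\<exists>P\<in>\<P>. P \<subseteq> Q)"
    using acc_finite_minimal_primes[OF acc rD] by (elim exE conjE)
  \<comment> \<open>The generator is quantified before \<open>Q\<close> so that
    \<open>bchoice\<close> selects \<open>g P\<close> alone; these finitely many elements go into
    \<open>J\<close>.\<close>
  have "\<forall>P\<in>\<P>. \<exists>a. \<exists>Q. t_prime R Q \<and> Q \<subseteq> P \<and> a \<in> I \<and> a \<noteq> 0 \<and> (\<forall>i\<in>I. i / a \<in> loc R Q) \<and>
      (\<forall>i\<in>I. \<forall>y\<in>loc R Q. \<exists>s\<in>R - P. s * (y * i) \<in> I)"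
  proof
    fix P assume "P \<in> \<P>"
    then have "t_prime R P" using P(2) by blast
    then show "\<exists>a. \<exists>Q. t_prime R Q \<and> Q \<subseteq> P \<and> a \<in> I \<and> a \<noteq> 0 \<and> (\<forall>i\<in>I. i / a \<in> loc R Q) \<and>
      (\<forall>i\<in>I. \<forall>y\<in>loc R Q. \<exists>s\<in>R - P. s * (y * i) \<in> I)"
      by (rule ideal_local_generator[OF disc _ I(1) I0]) (intro exI conjI)
  qed
  then obtain g where g: "\<forall>P\<in>\<P>. \<exists>Q. t_prime R Q \<and> Q \<subseteq> P \<and> g P \<in> I \<and> g P \<noteq> 0 \<and>
      (\<forall>i\<in>I. i / g P \<in> loc R Q) \<and> (\<forall>i\<in>I. \<forall>y\<in>loc R Q. \<exists>s\<in>R - P. s * (y * i) \<in> I)"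
    by (rule bchoice[THEN exE])
  define J where "J = insert i0 (J1 \<union> g ` \<P>)"
  have J: "finite J" "\<exists>j\<in>J. j \<noteq> 0" "J \<subseteq> I"
    using P(1) J1 i0 g by (auto simp: J_def)
  have main: "(c * i) * (k * b) \<in> loc R N"
    if c: "c \<in> colon R J" and i: "i \<in> I" and k: "k \<in> I" and b: "b \<in> colon R I" and N: "N \<in> t_Max R"
    for c i k b N
  proof (cases "D \<subseteq> N")
    case True
    have "t_radical D \<subseteq> N" by (rule t_radical_subset_prime[OF t_Max_t_prime[OF N] True])
    then obtain P where PP: "P \<in> \<P>" "P \<subseteq> N" using spec[OF P(3), of N] t_Max_t_prime[OF N] by blast
    then have Pt: "t_prime R P" and DP: "D \<subseteq> P" using P(2) t_radical_superset[OF DR] by blast+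
    note Pp = t_primeD(1)[OF Pt]
    obtain Q where Q: "t_prime R Q" "Q \<subseteq> P" "g P \<in> I" "g P \<noteq> 0" "\<forall>i\<in>I. i / g P \<in> loc R Q"
      "\<forall>i\<in>I. \<forall>y\<in>loc R Q. \<exists>s\<in>R - P. s * (y * i) \<in> I"
      using bspec[OF g PP(1)] by (elim exE conjE)
    note Qp = t_primeD(1)[OF Q(1)]
    \<comment> \<open>Otherwise the squared inverse of \<open>k * b\<close> lies in
      \<open>R_Q\<close> and sends \<open>k\<close> into \<open>I R_P\<close>. Multiplying by
      \<open>b\<close> leaves \<open>s / (k * b)\<close> in \<open>R\<close> with \<open>s\<close>
      outside \<open>P\<close>, while \<open>k * b\<close> is in \<open>D \<subseteq> P\<close>; so
      \<open>s\<close> would be in \<open>P\<close>.\<close>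
    have "k * b \<in> Q"
    proof (rule ccontr)
      assume n: "k * b \<notin> Q"
      have kbD: "k * b \<in> D" by (rule BI[OF k b])
      then have "k * b \<in> P" using DP by blast
      then have p: "k * b \<in> P" "k * b \<in> R - Q" using n kbD DR by blast+
      have "inverse (k * b) * inverse (k * b) \<in> loc R Q"
        using inverse_in_loc[OF Qp p(2)] by (intro loc_mult[OF Qp])
      then obtain s where s: "s \<in> R - P" "s * (inverse (k * b) * inverse (k * b) * k) \<in> I"
        using Q(6) k by blast
      then have "b * (s * (inverse (k * b) * inverse (k * b) * k)) \<in> R" using b by (simp add: colon_def)
      then have "(b * (s * (inverse (k * b) * inverse (k * b) * k))) * (k * b) \<in> P"
        using submod_mult[OF prime_idealD(2)[OF Pp]] p by blast
      moreover have "k * b \<noteq> 0" using n prime_idealD(5)[OF Qp] by metis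
      then have "(b * (s * (inverse (k * b) * inverse (k * b) * k))) * (k * b) = s" by (simp add: field_simps)
      ultimately have "s \<in> P" by (simp only:)
      then show False using s by blast
    qed
    \<comment> \<open>This is where \<open>g P\<close> belonging to \<open>J\<close> matters:
      \<open>c * g P\<close> is in \<open>R\<close> and \<open>i / g P\<close> is in
      \<open>R_Q\<close>.\<close>
    moreover have "c * i \<in> loc R Q"
    proof -
      have "c * g P \<in> R" using c PP(1) by (simp add: colon_def J_def)
      then have "(c * g P) * (i / g P) \<in> loc R Q"
        using Q(5) i by (intro loc_mult[OF Qp R_subset_loc[OF Qp]]) auto
      then show ?thesis using Q(4) by simp
    qed
    ultimately show ?thesis using mult_prime_in_loc[OF Qp N] Q(2) PP(2) by blast
  next
    case False
    then have "\<not> F \<subseteq> N" using t_radical_subset_prime[OF t_Max_t_prime[OF N], of F] F(3) by blast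
    then obtain f where f: "f \<in> F" "f \<notin> N" by blast
    \<comment> \<open>Outside \<open>D\<close>, the element \<open>f\<close> is a denominator:
      \<open>i * f\<close> lies in \<open>J1 E\<close>, where \<open>c\<close> clears
      \<open>J1\<close> and \<open>b\<close> clears \<open>E k \<subseteq> I\<close>.\<close>
    have "i * f \<in> mprod R J1 (Eend I)"
      by (rule mprod_mult_right[of f R J1 C])
         (use f J1 i in \<open>auto simp: C_def colon_def mult.commute\<close>)
    moreover have "mprod R J1 (Eend I) \<subseteq> {x. (c * (k * b)) * x \<in> R}"
    proof (rule mprod_least[OF submod_scaled[OF submod_R]])
      fix j e assume je: "j \<in> J1" "e \<in> Eend I"
      have "c * j \<in> R" using c je by (simp add: colon_def J_def)
      moreover have "b * (e * k) \<in> R" using b EendD[OF je(2) k] by (simp add: colon_def)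
      ultimately have "(c * j) * (b * (e * k)) \<in> R" by (rule R_mult)
      then show "j * e \<in> {x. (c * (k * b)) * x \<in> R}" by (simp add: ac_simps)
    qed
    ultimately have "(c * (k * b)) * (i * f) \<in> R" by blast
    then have "f * ((c * i) * (k * b)) \<in> R" by (simp add: ac_simps)
    moreover have "f \<in> R - N" using f F(2) DR by blast
    ultimately show ?thesis using mem_loc_prime[OF t_Max_prime[OF N]] by blast
  qed
  have JC: "c \<in> C" if c: "c \<in> colon R J" for c
    unfolding C_def colon_def[of "Eend I"]
  proof (intro CollectI ballI EendI)
    fix i k b assume ikb: "i \<in> I" "k \<in> I" "b \<in> colon R I"
    have "(c * i) * (k * b) \<in> R" using main[OF c ikb] by (rule Inter_loc)
    then show "c * i * k * b \<in> R" by (simp add: mult.assoc)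
  qed
  show ?thesis
    unfolding w_stable_iff[OF sI wI] C_def[symmetric]
  proof
    fix M assume M: "M \<in> t_Max R"
    obtain a s where a: "a \<in> J" "a \<noteq> 0" "s \<in> R - M" "s / a \<in> colon R J"
      by (rule finite_local_generator[OF J(1,2) M])
    then have "a * (s / a) \<in> mprod R I C" using J(3) JC by (intro mprod_memI) auto
    then have "s \<in> mprod R I C" using a(2) by simp
    then show "\<exists>s\<in>R - M. s \<in> mprod R I C" using a(3) by blast
  qed
qed

end

section \<open>The cycle of implications\<close>

theorem theorem2p4:
  fixes R :: "'a::field set"
  assumes "domain_with_qf R" and "PvMD R"
  shows "(generalized_Krull R \<longleftrightarrow>
            ((\<forall>I. radical_ideal R I \<and> t_ideal R I \<longrightarrow> divisorial R I) \<and>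
             (\<forall>I. ideal R I \<and> divisorial R I \<longrightarrow> w_stable R I)))
       \<and> (((\<forall>I. radical_ideal R I \<and> t_ideal R I \<longrightarrow> divisorial R I) \<and>
             (\<forall>I. ideal R I \<and> divisorial R I \<longrightarrow> w_stable R I))
            \<longleftrightarrow> (\<forall>I. radical_ideal R I \<and> t_ideal R I \<longrightarrow> w_stable R I))
       \<and> ((\<forall>I. radical_ideal R I \<and> t_ideal R I \<longrightarrow> w_stable R I)
            \<longleftrightarrow> (\<forall>P. t_prime R P \<longrightarrow> w_stable R P))"
    (is "(?i \<longleftrightarrow> ?ii) \<and> (?ii \<longleftrightarrow> ?iii) \<and> (?iii \<longleftrightarrow> ?iv)")
proof -
  interpret pvmd R using assms by unfold_locales
  have "?ii" if ?i
    using that radical_t_ideal_divisorial divisorial_w_stable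
    unfolding generalized_Krull_def by blast
  \<comment> \<open>A radical t-ideal is an ideal of \<open>R\<close>, and the first half of (ii)
    makes it divisorial, so the second half applies.\<close>
  moreover have "?iii" if ?ii
    using that unfolding radical_ideal_def by blast
  moreover have "?iv" if ?iii
    using that t_prime_radical by blast
  moreover have "?i" if iv: ?iv
    unfolding generalized_Krull_def strongly_discrete_def
  proof (intro conjI allI impI)
    show "acc_radical_t R"
      using iv w_stable_prime_finite by (intro acc_radical_tI) blast
  qed (use assms(2) iv w_stable_prime_not_idempotent in blast)+
  ultimately show ?thesis by argo
qed

end
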